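(* Let $(M^{3},\varphi,\xi,\eta,g)$ be a three-dimensional para-Kenmotsu manifold with scalar curvature $r$. If $M^{3}$ admits a Yamabe soliton for a vector field $V$ and a constant $\lambda\in\mathbb{R}$, i.e. $\mathcal{L}_Vg=(\lambda-r)g$, then $V$ cannot be pointwise collinear with $\xi$.
   Context: All manifolds are smooth and connected. A vector field $V$ is called pointwise collinear with $\xi$ if $V=b\xi$, where $b$ is a smooth function on $M$. An almost paracontact structure on a $(2n+1)$-dimensional manifold $M$ consists of a $(1,1)$-tensor field $\varphi$, a vector field $\xi$ and a $1$-form $\eta$ with $\eta(\xi)=1$, $\varphi^2=I-\eta\otimes\xi$, such that the $\pm1$-eigendistributions of $\varphi$ restricted to $\ker\eta$ both have dimension $n$ (so $\varphi\xi=0$, $\eta\circ\varphi=0$). It is an almost paracontact metric manifold if equipped with a semi-Riemannian metric $g$ with $g(\varphi X,\varphi Y)=-g(X,Y)+\eta(X)\eta(Y)$ for all $X,Y$. Its fundamental $2$-form is $\Phi(X,Y)=g(X,\varphi Y)$. It is normal if $[\varphi,\varphi]-2d\eta\otimes\xi=0$, where $[\varphi,\varphi](X,Y)=\varphi^2[X,Y]+[\varphi X,\varphi Y]-\varphi[\varphi X,Y]-\varphi[X,\varphi Y]$. A para-Kenmotsu manifold is a normal almost paracontact metric manifold with $d\eta=0$ and $d\Phi=2\eta\wedge\Phi$; such a manifold satisfies $(\nabla_X\varphi)Y=g(\varphi X,Y)\xi-\eta(Y)\varphi X$ and $\nabla_X\xi=X-\eta(X)\xi$, where $\nabla$ is the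 Levi-Civita connection. Curvature convention: $R(X,Y)Z=\nabla_X\nabla_YZ-\nabla_Y\nabla_XZ-\nabla_{[X,Y]}Z$, the Ricci tensor is $S(X,Y)=\operatorname{trace}\{Z\mapsto R(Z,X)Y\}$, and the scalar curvature $r$ is the $g$-trace of $S$. $\mathcal{L}$ denotes the Lie derivative.
   Formalization: The vector field V is assumed not to be identically zero: for V = 0 (b = 0) the claim fails, e.g. on R^3 with g = dt^2 + 2e^{2t} dx dy, ξ = ∂_t, r = λ = -6, where V = 0 is a Yamabe soliton field collinear with ξ. *)

theory Defs
  imports "HOL-Analysis.Analysis" "HOL-Library.Function_Algebras"
begin

section \<open>Pointwise real vector space structure on functions\<close>

instantiation "fun" :: (type, real_vector) real_vector
begin

definition scaleR_fun :: "real \<Rightarrow> ('a \<Rightarrow> 'b) \<Rightarrow> 'a \<Rightarrow> 'b" where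
  "scaleR_fun a f = (\<lambda>x. a *\<^sub>R f x)"

instance
  by standard (auto simp: scaleR_fun_def plus_fun_def fun_eq_iff algebra_simps)

end

definition linear_over :: "'a::real_vector set \<Rightarrow> ('a \<Rightarrow> 'b::real_vector) \<Rightarrow> bool" where
  "linear_over W L \<longleftrightarrow>
     (\<forall>u\<in>W. \<forall>v\<in>W. L (u + v) = L u + L v) \<and> (\<forall>a. \<forall>v\<in>W. L (a *\<^sub>R v) = a *\<^sub>R L v)"

text \<open>Trace of a linear endomorphism of a finite-dimensional subspace, computed in any basis
  of that subspace.\<close>

definition trace_over :: "'a::real_vector set \<Rightarrow> ('a \<Rightarrow> 'a) \<Rightarrow> real" where
  "trace_over W L =
     (let B = (SOME B. independent B \<and> span B = W) in \<Sum>b\<in>B. representation B (L b) b)"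


section \<open>Smooth manifolds\<close>

primrec Ck_on :: "nat \<Rightarrow> 'e::euclidean_space set \<Rightarrow> ('e \<Rightarrow> 'f::real_normed_vector) \<Rightarrow> bool" where
  "Ck_on 0 S f \<longleftrightarrow> continuous_on S f"
| "Ck_on (Suc k) S f \<longleftrightarrow>
     (\<forall>x\<in>S. f differentiable (at x)) \<and> (\<forall>v. Ck_on k S (\<lambda>x. frechet_derivative f (at x) v))"

text \<open>Only used for open \<open>S\<close>.\<close>

definition smooth_on :: "'e::euclidean_space set \<Rightarrow> ('e \<Rightarrow> 'f::real_normed_vector) \<Rightarrow> bool" where
  "smooth_on S f \<longleftrightarrow> (\<forall>k. Ck_on k S f)"

type_synonym ('m, 'e) atlas = "('m set \<times> ('m \<Rightarrow> 'e)) set"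

text \<open>The underlying topological space of the manifold is the whole type \<open>'m\<close>; a chart is a
  pair of an open domain and a map that matters only on that domain.\<close>

definition smooth_manifold ::
  "('m::{t2_space, second_countable_topology}, 'e::euclidean_space) atlas \<Rightarrow> bool" where
  "smooth_manifold A \<longleftrightarrow>
     connected (UNIV :: 'm set) \<and>
     (\<Union>(U, c)\<in>A. U) = UNIV \<and>
     (\<forall>(U, c)\<in>A. open U \<and> open (c ` U) \<and> homeomorphism U (c ` U) c (inv_into U c)) \<and>
     (\<forall>(U, c)\<in>A. \<forall>(U', c')\<in>A. smooth_on (c ` (U \<inter> U')) (c' \<circ> inv_into U c))"

definition smooth_funs :: "('m, 'e::euclidean_space) atlas \<Rightarrow> ('m \<Rightarrow> real) set" where
  "smooth_funs A = {f. \<forall>(U, c)\<in>A. smooth_on (c ` U) (f \<circ> inv_into U c)}"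


section \<open>Tangent vectors and vector fields\<close>

type_synonym 'm tangent = "('m \<Rightarrow> real) \<Rightarrow> real"
type_synonym 'm vfield = "'m \<Rightarrow> 'm tangent"

text \<open>Tangent vectors at \<open>p\<close> are the derivations at \<open>p\<close> of the algebra of smooth functions; being
  total functions in HOL, they are normalised to vanish on non-smooth arguments.\<close>

definition tangent_space :: "('m, 'e::euclidean_space) atlas \<Rightarrow> 'm \<Rightarrow> 'm tangent set" where
  "tangent_space A p = {v.
     (\<forall>f\<in>smooth_funs A. \<forall>h\<in>smooth_funs A. v (\<lambda>x. f x + h x) = v f + v h) \<and>
     (\<forall>a. \<forall>f\<in>smooth_funs A. v (\<lambda>x. a * f x) = a * v f) \<and>
     (\<forall>f\<in>smooth_funs A. \<forall>h\<in>smooth_funs A. v (\<lambda>x. f x * h x) = v f * h p + f p * v h) \<and>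
     (\<forall>f. f \<notin> smooth_funs A \<longrightarrow> v f = 0)}"

definition vector_fields :: "('m, 'e::euclidean_space) atlas \<Rightarrow> 'm vfield set" where
  "vector_fields A = {X. (\<forall>p. X p \<in> tangent_space A p) \<and>
     (\<forall>f\<in>smooth_funs A. (\<lambda>p. X p f) \<in> smooth_funs A)}"

definition lie_bracket :: "'m vfield \<Rightarrow> 'm vfield \<Rightarrow> 'm vfield" where
  "lie_bracket X Y = (\<lambda>p f. X p (\<lambda>q. Y q f) - Y p (\<lambda>q. X q f))"


section \<open>Tensor fields\<close>

text \<open>Tensor fields are families of (multi)linear maps on the tangent spaces taking smooth vector
  fields to smooth objects.  Their values outside the tangent spaces are irrelevant.\<close>

type_synonym 'm one_form = "'m \<Rightarrow> 'm tangent \<Rightarrow> real"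
type_synonym 'm two_tensor = "'m \<Rightarrow> 'm tangent \<Rightarrow> 'm tangent \<Rightarrow> real"
type_synonym 'm endo_field = "'m \<Rightarrow> 'm tangent \<Rightarrow> 'm tangent"

definition smooth_one_form :: "('m, 'e::euclidean_space) atlas \<Rightarrow> 'm one_form \<Rightarrow> bool" where
  "smooth_one_form A \<omega> \<longleftrightarrow>
     (\<forall>p. linear_over (tangent_space A p) (\<omega> p)) \<and>
     (\<forall>X\<in>vector_fields A. (\<lambda>p. \<omega> p (X p)) \<in> smooth_funs A)"

definition smooth_endo_field :: "('m, 'e::euclidean_space) atlas \<Rightarrow> 'm endo_field \<Rightarrow> bool" where
  "smooth_endo_field A F \<longleftrightarrow>
     (\<forall>p. linear_over (tangent_space A p) (F p) \<and> F p ` tangent_space A p \<subseteq> tangent_space A p) \<and>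
     (\<forall>X\<in>vector_fields A. (\<lambda>p. F p (X p)) \<in> vector_fields A)"

definition smooth_two_tensor :: "('m, 'e::euclidean_space) atlas \<Rightarrow> 'm two_tensor \<Rightarrow> bool" where
  "smooth_two_tensor A T \<longleftrightarrow>
     (\<forall>p. \<forall>u\<in>tangent_space A p.
        linear_over (tangent_space A p) (T p u) \<and>
        linear_over (tangent_space A p) (\<lambda>v. T p v u)) \<and>
     (\<forall>X\<in>vector_fields A. \<forall>Y\<in>vector_fields A. (\<lambda>p. T p (X p) (Y p)) \<in> smooth_funs A)"

text \<open>Constancy of the index need not be required: it follows from connectedness.\<close>

definition semi_riemannian_metric :: "('m, 'e::euclidean_space) atlas \<Rightarrow> 'm two_tensor \<Rightarrow> bool" where
  "semi_riemannian_metric A g \<longleftrightarrow>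
     smooth_two_tensor A g \<and>
     (\<forall>p. \<forall>u\<in>tangent_space A p. \<forall>v\<in>tangent_space A p. g p u v = g p v u) \<and>
     (\<forall>p. \<forall>u\<in>tangent_space A p. (\<forall>v\<in>tangent_space A p. g p u v = 0) \<longrightarrow> u = 0)"

text \<open>Exterior derivative and wedge product carry the normalising factors \<open>1/2\<close> and \<open>1/3\<close> for
  which \<open>[\<phi>,\<phi>] - 2 d\<eta> \<otimes> \<xi>\<close> is the usual normality tensor.\<close>

definition ext_deriv1 :: "'m one_form \<Rightarrow> 'm vfield \<Rightarrow> 'm vfield \<Rightarrow> 'm \<Rightarrow> real" where
  "ext_deriv1 \<omega> X Y = (\<lambda>p. (1/2) *
     (X p (\<lambda>q. \<omega> q (Y q)) - Y p (\<lambda>q. \<omega> q (X q)) - \<omega> p (lie_bracket X Y p)))"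

definition ext_deriv2 :: "'m two_tensor \<Rightarrow> 'm vfield \<Rightarrow> 'm vfield \<Rightarrow> 'm vfield \<Rightarrow> 'm \<Rightarrow> real" where
  "ext_deriv2 \<Omega> X Y Z = (\<lambda>p. (1/3) *
     (X p (\<lambda>q. \<Omega> q (Y q) (Z q)) + Y p (\<lambda>q. \<Omega> q (Z q) (X q)) + Z p (\<lambda>q. \<Omega> q (X q) (Y q))
      - \<Omega> p (lie_bracket X Y p) (Z p) - \<Omega> p (lie_bracket Y Z p) (X p)
      - \<Omega> p (lie_bracket Z X p) (Y p)))"

definition wedge12 ::
  "'m one_form \<Rightarrow> 'm two_tensor \<Rightarrow> 'm vfield \<Rightarrow> 'm vfield \<Rightarrow> 'm vfield \<Rightarrow> 'm \<Rightarrow> real" where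
  "wedge12 \<omega> \<Omega> X Y Z = (\<lambda>p. (1/3) *
     (\<omega> p (X p) * \<Omega> p (Y p) (Z p) + \<omega> p (Y p) * \<Omega> p (Z p) (X p)
      + \<omega> p (Z p) * \<Omega> p (X p) (Y p)))"

definition lie_deriv :: "'m vfield \<Rightarrow> 'm two_tensor \<Rightarrow> 'm vfield \<Rightarrow> 'm vfield \<Rightarrow> 'm \<Rightarrow> real" where
  "lie_deriv V T X Y = (\<lambda>p. V p (\<lambda>q. T q (X q) (Y q))
     - T p (lie_bracket V X p) (Y p) - T p (X p) (lie_bracket V Y p))"


section \<open>Levi-Civita connection and curvature\<close>

type_synonym 'm connection = "'m vfield \<Rightarrow> 'm vfield \<Rightarrow> 'm vfield"

definition affine_connection :: "('m, 'e::euclidean_space) atlas \<Rightarrow> 'm connection \<Rightarrow> bool" where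
  "affine_connection A D \<longleftrightarrow>
     (\<forall>X\<in>vector_fields A. \<forall>Y\<in>vector_fields A. D X Y \<in> vector_fields A) \<and>
     (\<forall>X\<in>vector_fields A. \<forall>Y\<in>vector_fields A. \<forall>Z\<in>vector_fields A.
        D (\<lambda>p. X p + Y p) Z = (\<lambda>p. D X Z p + D Y Z p) \<and>
        D X (\<lambda>p. Y p + Z p) = (\<lambda>p. D X Y p + D X Z p)) \<and>
     (\<forall>f\<in>smooth_funs A. \<forall>X\<in>vector_fields A. \<forall>Y\<in>vector_fields A.
        D (\<lambda>p. f p *\<^sub>R X p) Y = (\<lambda>p. f p *\<^sub>R D X Y p) \<and>
        D X (\<lambda>p. f p *\<^sub>R Y p) = (\<lambda>p. X p f *\<^sub>R Y p + f p *\<^sub>R D X Y p))"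

definition levi_civita ::
  "('m, 'e::euclidean_space) atlas \<Rightarrow> 'm two_tensor \<Rightarrow> 'm connection \<Rightarrow> bool" where
  "levi_civita A g D \<longleftrightarrow>
     affine_connection A D \<and>
     (\<forall>X\<in>vector_fields A. \<forall>Y\<in>vector_fields A.
        (\<lambda>p. D X Y p - D Y X p) = lie_bracket X Y) \<and>
     (\<forall>X\<in>vector_fields A. \<forall>Y\<in>vector_fields A. \<forall>Z\<in>vector_fields A. \<forall>p.
        X p (\<lambda>q. g q (Y q) (Z q)) = g p (D X Y p) (Z p) + g p (Y p) (D X Z p))"

definition curvature :: "'m connection \<Rightarrow> 'm vfield \<Rightarrow> 'm vfield \<Rightarrow> 'm vfield \<Rightarrow> 'm vfield" where
  "curvature D X Y Z = (\<lambda>p. D X (D Y Z) p - D Y (D X Z) p - D (lie_bracket X Y) Z p)"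

text \<open>The curvature is tensorial, so its value at \<open>p\<close> on tangent vectors is obtained from arbitrary
  extensions to vector fields.\<close>

definition extend :: "('m, 'e::euclidean_space) atlas \<Rightarrow> 'm \<Rightarrow> 'm tangent \<Rightarrow> 'm vfield" where
  "extend A p v = (SOME X. X \<in> vector_fields A \<and> X p = v)"

definition curvature_at :: "('m, 'e::euclidean_space) atlas \<Rightarrow> 'm connection \<Rightarrow> 'm \<Rightarrow>
    'm tangent \<Rightarrow> 'm tangent \<Rightarrow> 'm tangent \<Rightarrow> 'm tangent" where
  "curvature_at A D p u v w = curvature D (extend A p u) (extend A p v) (extend A p w) p"

definition ricci :: "('m, 'e::euclidean_space) atlas \<Rightarrow> 'm connection \<Rightarrow> 'm two_tensor" where
  "ricci A D p u v = trace_over (tangent_space A p) (\<lambda>w. curvature_at A D p w u v)"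

text \<open>The \<open>g\<close>-trace of a bilinear form \<open>T\<close> is the trace of the endomorphism \<open>Q\<close> with
  \<open>g (Q u) v = T u v\<close>.\<close>

definition metric_trace ::
  "('m, 'e::euclidean_space) atlas \<Rightarrow> 'm two_tensor \<Rightarrow> 'm two_tensor \<Rightarrow> 'm \<Rightarrow> real" where
  "metric_trace A g T p = trace_over (tangent_space A p)
     (\<lambda>u. THE w. w \<in> tangent_space A p \<and> (\<forall>v\<in>tangent_space A p. g p w v = T p u v))"

definition scalar_curvature ::
  "('m, 'e::euclidean_space) atlas \<Rightarrow> 'm two_tensor \<Rightarrow> 'm connection \<Rightarrow> 'm \<Rightarrow> real" where
  "scalar_curvature A g D = metric_trace A g (ricci A D)"


section \<open>Almost paracontact and para-Kenmotsu structures\<close>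

definition almost_paracontact :: "('m::{t2_space, second_countable_topology},
    'e::euclidean_space) atlas \<Rightarrow> 'm endo_field \<Rightarrow> 'm vfield \<Rightarrow> 'm one_form \<Rightarrow> bool" where
  "almost_paracontact A \<phi> \<xi> \<eta> \<longleftrightarrow>
     smooth_manifold A \<and> smooth_endo_field A \<phi> \<and> \<xi> \<in> vector_fields A \<and> smooth_one_form A \<eta> \<and>
     (\<forall>p. \<eta> p (\<xi> p) = 1) \<and>
     (\<forall>p. \<forall>v\<in>tangent_space A p. \<phi> p (\<phi> p v) = v - \<eta> p v *\<^sub>R \<xi> p) \<and>
     (\<exists>n. DIM('e) = 2 * n + 1 \<and>
        (\<forall>p. dim {v \<in> tangent_space A p. \<eta> p v = 0 \<and> \<phi> p v = v} = n \<and>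
             dim {v \<in> tangent_space A p. \<eta> p v = 0 \<and> \<phi> p v = - v} = n))"

definition almost_paracontact_metric :: "('m::{t2_space, second_countable_topology},
    'e::euclidean_space) atlas \<Rightarrow> 'm endo_field \<Rightarrow> 'm vfield \<Rightarrow> 'm one_form \<Rightarrow> 'm two_tensor \<Rightarrow> bool"
  where
  "almost_paracontact_metric A \<phi> \<xi> \<eta> g \<longleftrightarrow>
     almost_paracontact A \<phi> \<xi> \<eta> \<and> semi_riemannian_metric A g \<and>
     (\<forall>p. \<forall>u\<in>tangent_space A p. \<forall>v\<in>tangent_space A p.
        g p (\<phi> p u) (\<phi> p v) = - g p u v + \<eta> p u * \<eta> p v)"

definition fundamental_form :: "'m endo_field \<Rightarrow> 'm two_tensor \<Rightarrow> 'm two_tensor" where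
  "fundamental_form \<phi> g = (\<lambda>p u v. g p u (\<phi> p v))"

definition endo_torsion :: "'m endo_field \<Rightarrow> 'm vfield \<Rightarrow> 'm vfield \<Rightarrow> 'm vfield" where
  "endo_torsion \<phi> X Y =
     (let \<phi>X = (\<lambda>q. \<phi> q (X q)); \<phi>Y = (\<lambda>q. \<phi> q (Y q)) in
      (\<lambda>p. \<phi> p (\<phi> p (lie_bracket X Y p)) + lie_bracket \<phi>X \<phi>Y p
         - \<phi> p (lie_bracket \<phi>X Y p) - \<phi> p (lie_bracket X \<phi>Y p)))"

definition normal_structure :: "('m, 'e::euclidean_space) atlas \<Rightarrow>
    'm endo_field \<Rightarrow> 'm vfield \<Rightarrow> 'm one_form \<Rightarrow> bool" where
  "normal_structure A \<phi> \<xi> \<eta> \<longleftrightarrow>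
     (\<forall>X\<in>vector_fields A. \<forall>Y\<in>vector_fields A. \<forall>p.
        endo_torsion \<phi> X Y p - (2 * ext_deriv1 \<eta> X Y p) *\<^sub>R \<xi> p = 0)"

definition para_kenmotsu :: "('m::{t2_space, second_countable_topology},
    'e::euclidean_space) atlas \<Rightarrow> 'm endo_field \<Rightarrow> 'm vfield \<Rightarrow> 'm one_form \<Rightarrow> 'm two_tensor \<Rightarrow> bool"
  where
  "para_kenmotsu A \<phi> \<xi> \<eta> g \<longleftrightarrow>
     almost_paracontact_metric A \<phi> \<xi> \<eta> g \<and> normal_structure A \<phi> \<xi> \<eta> \<and>
     (\<forall>X\<in>vector_fields A. \<forall>Y\<in>vector_fields A. \<forall>p. ext_deriv1 \<eta> X Y p = 0) \<and>
     (\<forall>X\<in>vector_fields A. \<forall>Y\<in>vector_fields A. \<forall>Z\<in>vector_fields A. \<forall>p.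
        ext_deriv2 (fundamental_form \<phi> g) X Y Z p =
          2 * wedge12 \<eta> (fundamental_form \<phi> g) X Y Z p)"


section \<open>Yamabe solitons\<close>

definition yamabe_soliton :: "('m, 'e::euclidean_space) atlas \<Rightarrow> 'm two_tensor \<Rightarrow> 'm connection \<Rightarrow>
    'm vfield \<Rightarrow> real \<Rightarrow> bool" where
  "yamabe_soliton A g D V lam \<longleftrightarrow>
     V \<in> vector_fields A \<and>
     (\<forall>X\<in>vector_fields A. \<forall>Y\<in>vector_fields A. \<forall>p.
        lie_deriv V g X Y p = (lam - scalar_curvature A g D p) * g p (X p) (Y p))"

definition pointwise_collinear :: "('m, 'e::euclidean_space) atlas \<Rightarrow> 'm vfield \<Rightarrow> 'm vfield \<Rightarrow> bool"
  where
  "pointwise_collinear A V \<xi> \<longleftrightarrow> (\<exists>b\<in>smooth_funs A. \<forall>p. V p = b p *\<^sub>R \<xi> p)"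

end

theory Submission
  imports Defs "HOL-Computational_Algebra.Polynomial"
begin

text \<open>Let \<open>V = b \<xi>\<close>.  As \<open>\<nabla>\<^sub>X \<xi> = X - \<eta>(X) \<xi>\<close>, evaluating the soliton equation on \<open>(\<xi>, \<xi>)\<close> and on
  \<open>ker \<eta>\<close> gives \<open>lam - r = 2 \<xi>(b) = 2 b\<close>.  In dimension three the curvature is determined by
  \<open>r\<close>, and the second Bianchi identity in the directions \<open>\<xi>, E, F\<close>, with \<open>E\<close> and \<open>F\<close> null
  eigenfields of \<open>\<phi>\<close>, yields \<open>\<xi>(r) = -2 (r + 6)\<close>.  Hence \<open>3 b = lam + 6\<close>, so \<open>b\<close> is constant
  and \<open>b = \<xi>(b) = 0\<close>.

  Tangent vectors extend to global fields by bump functions: the tangent space is spanned by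
  \<open>\<xi>\<close> and the two eigenlines of \<open>\<phi>\<close>, so by dimension it is already spanned by the coordinate
  derivations of a chart.\<close>

text \<open>Derivations act on functions defined on the whole manifold and \<open>D\<close> acts on
  global fields, so an identity can be differentiated only once it holds at every point, while a
  null frame need not exist globally. Hence \<open>E\<close> and \<open>F\<close> are global
  eigenfields that may vanish, and identities are multiplied by powers of \<open>h = G E F\<close>
  until they hold everywhere; division by \<open>h\<close> takes place only at single points with
  \<open>h p \<noteq> 0\<close>. Curvature components containing \<xi> are those of constant
  curvature -1. The only remaining one is \<open>k = G (R E F F) E\<close>, with
  \<open>r * h^2 + 4 * h^2 + 2 * k = 0\<close>. The number 6 reflects that r = -6 is the scalar
  curvature of constant curvature -1 in dimension three. Since \<open>k\<close> and
  \<open>h^2\<close> scale in the same way when \<open>E\<close> and \<open>F\<close> are rescaled,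
  the unknown coefficients of the brackets with \<xi> cancel from \<xi>(r). Smoothness of r, needed
  to differentiate it, is read off from the soliton equation.\<close>

section \<open>Smooth functions on Euclidean spaces\<close>

lemma Ck_on_subset: "Ck_on k S f \<Longrightarrow> T \<subseteq> S \<Longrightarrow> Ck_on k T f"
  by (induction k arbitrary: f) (auto intro: continuous_on_subset)

lemma Ck_on_cong:
  assumes "open S" "\<And>x. x \<in> S \<Longrightarrow> f x = h x" "Ck_on k S f"
  shows "Ck_on k S h"
  using assms(2,3)
proof (induction k arbitrary: f h)
  case 0
  then show ?case by (metis Ck_on.simps(1) continuous_on_cong)
next
  case (Suc k)
  have d: "(h has_derivative frechet_derivative f (at x)) (at x)" if "x \<in> S" for x
    using Suc.prems that assms(1)
    by (metis Ck_on.simps(2) frechet_derivative_works has_derivative_transform_within_open)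
  then have eq: "frechet_derivative f (at x) = frechet_derivative h (at x)" if "x \<in> S" for x
    using that frechet_derivative_at by blast
  show ?case
    unfolding Ck_on.simps
  proof (intro conjI ballI allI)
    show "h differentiable at x" if "x \<in> S" for x
      using d[OF that] differentiableI by blast
    show "Ck_on k S (\<lambda>x. frechet_derivative h (at x) v)" for v
      by (rule Suc.IH[of "\<lambda>x. frechet_derivative f (at x) v"]) (use Suc.prems eq in auto)
  qed
qed

lemma Ck_on_Un: "open S \<Longrightarrow> open T \<Longrightarrow> Ck_on k S f \<Longrightarrow> Ck_on k T f \<Longrightarrow> Ck_on k (S \<union> T) f"
  by (induction k arbitrary: f) (auto intro: continuous_on_open_Un)

text \<open>Derivatives at a point are unique, so any explicit \<open>F\<close> may stand for the
  chosen \<open>frechet_derivative\<close>. The closure properties below all follow by induction on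
  the order through this rule.\<close>

lemma Ck_on_SucI:
  assumes "open S" "\<And>x. x \<in> S \<Longrightarrow> (f has_derivative F x) (at x)" "\<And>v. Ck_on k S (\<lambda>x. F x v)"
  shows "Ck_on (Suc k) S f"
  unfolding Ck_on.simps
proof (intro conjI ballI allI)
  show "f differentiable at x" if "x \<in> S" for x
    using assms(2)[OF that] differentiableI by blast
  show "Ck_on k S (\<lambda>x. frechet_derivative f (at x) v)" for v
    by (rule Ck_on_cong[OF assms(1) _ assms(3)[of v]]) (metis assms(2) frechet_derivative_at)
qed

lemma Ck_on_SucD:
  assumes "Ck_on (Suc k) S f"
  shows "x \<in> S \<Longrightarrow> (f has_derivative frechet_derivative f (at x)) (at x)"
    and "Ck_on k S (\<lambda>x. frechet_derivative f (at x) v)"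
  using assms frechet_derivative_works by auto

lemma Ck_on_lower: "Ck_on (Suc k) S f \<Longrightarrow> Ck_on k S f"
proof (induction k arbitrary: f)
  case 0
  then show ?case
    by (simp add: continuous_at_imp_continuous_on differentiable_imp_continuous_within)
next
  case (Suc k)
  then show ?case by (metis Ck_on.simps(2))
qed

lemma Ck_on_const: "open S \<Longrightarrow> Ck_on k S (\<lambda>x. c)"
proof (induction k arbitrary: c)
  case (Suc k)
  then show ?case by (intro Ck_on_SucI[of S _ "\<lambda>x v. 0"]) auto
qed simp

lemma Ck_on_add: "open S \<Longrightarrow> Ck_on k S f \<Longrightarrow> Ck_on k S h \<Longrightarrow> Ck_on k S (\<lambda>x. f x + h x)"
proof (induction k arbitrary: f h)
  case 0
  then show ?case by (auto intro: continuous_intros)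
next
  case (Suc k)
  show ?case
    by (rule Ck_on_SucI[OF Suc.prems(1) has_derivative_add[OF Ck_on_SucD(1)[OF Suc.prems(2)]
            Ck_on_SucD(1)[OF Suc.prems(3)]]])
      (auto intro: Suc.IH Suc.prems(1) Ck_on_SucD(2)[OF Suc.prems(2)] Ck_on_SucD(2)[OF Suc.prems(3)])
qed

lemma Ck_on_sum:
  assumes "open S" "\<And>i. i \<in> I \<Longrightarrow> Ck_on k S (f i)"
  shows "Ck_on k S (\<lambda>x. \<Sum>i\<in>I. f i x)"
  using assms(2)
  by (induction I rule: infinite_finite_induct) (auto intro: Ck_on_add Ck_on_const assms(1))

lemma Ck_on_mult:
  fixes f h :: "_ \<Rightarrow> real"
  shows "open S \<Longrightarrow> Ck_on k S f \<Longrightarrow> Ck_on k S h \<Longrightarrow> Ck_on k S (\<lambda>x. f x * h x)"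
proof (induction k arbitrary: f h)
  case 0
  then show ?case by (auto intro: continuous_intros)
next
  case (Suc k)
  show ?case
  proof (rule Ck_on_SucI[OF Suc.prems(1) has_derivative_mult[OF Ck_on_SucD(1)[OF Suc.prems(2)]
            Ck_on_SucD(1)[OF Suc.prems(3)]]])
    show "Ck_on k S (\<lambda>x. f x * frechet_derivative h (at x) v + frechet_derivative f (at x) v * h x)" for v
      by (intro Ck_on_add Suc.prems(1) Suc.IH Ck_on_SucD(2) Suc.prems Ck_on_lower)
  qed
qed

lemma Ck_on_inner: "open S \<Longrightarrow> Ck_on k S f \<Longrightarrow> Ck_on k S (\<lambda>x. f x \<bullet> b)"
proof (induction k arbitrary: f)
  case 0
  then show ?case by (auto intro: continuous_intros)
next
  case (Suc k)
  show ?case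
    by (rule Ck_on_SucI[OF Suc.prems(1) has_derivative_inner_left[OF Ck_on_SucD(1)[OF Suc.prems(2)]]])
      (auto intro: Suc.IH Suc.prems(1) Ck_on_SucD(2)[OF Suc.prems(2)])
qed

lemma Ck_on_ident: "open S \<Longrightarrow> Ck_on k S (\<lambda>x. x)"
proof (cases k)
  case (Suc l)
  assume "open S"
  then show ?thesis
    unfolding Suc by (intro Ck_on_SucI[of S _ "\<lambda>x v. v"]) (auto intro: Ck_on_const)
qed auto

lemma Ck_on_compose:
  fixes f :: "'f::euclidean_space \<Rightarrow> real" and h :: "'e::euclidean_space \<Rightarrow> 'f"
  shows "open S \<Longrightarrow> open T \<Longrightarrow> h ` S \<subseteq> T \<Longrightarrow> Ck_on k T f \<Longrightarrow> Ck_on k S h \<Longrightarrow> Ck_on k S (\<lambda>x. f (h x))"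
proof (induction k arbitrary: f)
  case 0
  then show ?case by (auto intro: continuous_on_compose2)
next
  case (Suc k)
  let ?f = "\<lambda>x. frechet_derivative f (at x)" and ?h = "\<lambda>x. frechet_derivative h (at x)"
  show ?case
  proof (rule Ck_on_SucI[OF Suc.prems(1)])
    fix x assume x: "x \<in> S"
    have hd: "(h has_derivative ?h x) (at x)" and fd: "(f has_derivative ?f (h x)) (at (h x))"
      using x Suc.prems Ck_on_SucD by blast+
    have "((\<lambda>x. f (h x)) has_derivative (\<lambda>v. ?f (h x) (?h x v))) (at x)"
      using has_derivative_compose[OF hd fd] .
    \<comment> \<open>The direction \<open>?h x v\<close> varies with \<open>x\<close>. Expanding it
      in the basis leaves derivatives of \<open>f\<close> in fixed directions, composed with
      \<open>h\<close>, to which the induction hypothesis applies.\<close>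
    moreover have "?f (h x) (?h x v) = (\<Sum>b\<in>Basis. (?h x v \<bullet> b) * ?f (h x) b)" for v
    proof -
      have lin: "linear (?f (h x))" using fd has_derivative_linear by blast
      have "?f (h x) (?h x v) = ?f (h x) (\<Sum>b\<in>Basis. (?h x v \<bullet> b) *\<^sub>R b)"
        by (simp add: euclidean_representation)
      then show ?thesis by (simp add: linear_sum[OF lin] linear_cmul[OF lin])
    qed
    ultimately show "((\<lambda>x. f (h x)) has_derivative (\<lambda>v. \<Sum>b\<in>Basis. (?h x v \<bullet> b) * ?f (h x) b)) (at x)"
      by simp
  next
    show "Ck_on k S (\<lambda>x. \<Sum>b\<in>Basis. (?h x v \<bullet> b) * ?f (h x) b)" for v
      by (intro Ck_on_sum Ck_on_mult Ck_on_inner Suc.IH Suc.prems(1,2,3) Ck_on_SucD(2)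
          Suc.prems(4,5) Ck_on_lower)
  qed
qed

lemma smooth_on_subset: "smooth_on S f \<Longrightarrow> T \<subseteq> S \<Longrightarrow> smooth_on T f"
  unfolding smooth_on_def using Ck_on_subset by blast

lemma smooth_on_cong: "open S \<Longrightarrow> (\<And>x. x \<in> S \<Longrightarrow> f x = h x) \<Longrightarrow> smooth_on S f \<Longrightarrow> smooth_on S h"
  unfolding smooth_on_def using Ck_on_cong by blast

lemma smooth_on_Un: "open S \<Longrightarrow> open T \<Longrightarrow> smooth_on S f \<Longrightarrow> smooth_on T f \<Longrightarrow> smooth_on (S \<union> T) f"
  unfolding smooth_on_def using Ck_on_Un by blast

lemma smooth_on_const: "open S \<Longrightarrow> smooth_on S (\<lambda>x. c)"
  unfolding smooth_on_def using Ck_on_const by blast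

lemma smooth_on_ident: "open S \<Longrightarrow> smooth_on S (\<lambda>x. x)"
  unfolding smooth_on_def using Ck_on_ident by blast

lemma smooth_on_add: "open S \<Longrightarrow> smooth_on S f \<Longrightarrow> smooth_on S h \<Longrightarrow> smooth_on S (\<lambda>x. f x + h x)"
  unfolding smooth_on_def using Ck_on_add by blast

lemma smooth_on_sum:
  "open S \<Longrightarrow> (\<And>i. i \<in> I \<Longrightarrow> smooth_on S (f i)) \<Longrightarrow> smooth_on S (\<lambda>x. \<Sum>i\<in>I. f i x)"
  by (simp add: smooth_on_def Ck_on_sum)

lemma smooth_on_mult:
  fixes f h :: "_ \<Rightarrow> real"
  shows "open S \<Longrightarrow> smooth_on S f \<Longrightarrow> smooth_on S h \<Longrightarrow> smooth_on S (\<lambda>x. f x * h x)"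
  unfolding smooth_on_def using Ck_on_mult by blast

lemma smooth_on_inner: "open S \<Longrightarrow> smooth_on S f \<Longrightarrow> smooth_on S (\<lambda>x. f x \<bullet> b)"
  unfolding smooth_on_def using Ck_on_inner by blast

lemma smooth_on_compose:
  fixes f :: "'f::euclidean_space \<Rightarrow> real" and h :: "'e::euclidean_space \<Rightarrow> 'f"
  shows "open S \<Longrightarrow> open T \<Longrightarrow> h ` S \<subseteq> T \<Longrightarrow> smooth_on T f \<Longrightarrow> smooth_on S h
    \<Longrightarrow> smooth_on S (\<lambda>x. f (h x))"
  by (simp add: smooth_on_def Ck_on_compose[where T = T])

lemma smooth_on_has_derivative:
  "smooth_on S f \<Longrightarrow> x \<in> S \<Longrightarrow> (f has_derivative frechet_derivative f (at x)) (at x)"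
  unfolding smooth_on_def using Ck_on_SucD(1)[of 0] by fast

lemma smooth_on_frechet_derivative:
  "smooth_on S f \<Longrightarrow> smooth_on S (\<lambda>x. frechet_derivative f (at x) v)"
  by (simp add: smooth_on_def Ck_on_SucD(2))

text \<open>The polynomial factor in \<open>1 / t\<close> makes this family closed under differentiation.\<close>

definition exp_cutoff :: "real poly \<Rightarrow> real \<Rightarrow> real" where
  "exp_cutoff P t = (if 0 < t then poly P (1 / t) * exp (- (1 / t)) else 0)"

lemma poly_times_exp_minus_tendsto_0:
  fixes P :: "real poly"
  shows "((\<lambda>s. poly P s * exp (- s)) \<longlongrightarrow> 0) at_top"
proof -
  have "((\<lambda>s. \<Sum>i\<le>degree P. coeff P i * (s ^ i / exp s)) \<longlongrightarrow> (\<Sum>i\<le>degree P. coeff P i * 0)) at_top"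
    by (intro tendsto_sum tendsto_mult tendsto_const tendsto_power_div_exp_0)
  then show ?thesis
    by (simp add: poly_altdef sum_distrib_right exp_minus divide_inverse mult.assoc)
qed

lemma exp_cutoff_tendsto_0: "(exp_cutoff P \<longlongrightarrow> 0) (at 0)"
proof -
  have "((\<lambda>t. poly P (inverse t) * exp (- inverse t)) \<longlongrightarrow> 0) (at_right 0)"
    by (rule filterlim_compose[OF poly_times_exp_minus_tendsto_0 filterlim_inverse_at_top_right])
  then have "(exp_cutoff P \<longlongrightarrow> 0) (at_right 0)"
    by (rule Lim_transform_eventually)
      (auto simp: exp_cutoff_def eventually_at_filter inverse_eq_divide)
  moreover have "(exp_cutoff P \<longlongrightarrow> 0) (at_left 0)"
    by (rule Lim_transform_eventually[OF tendsto_const])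
      (auto simp: exp_cutoff_def eventually_at_filter)
  ultimately show ?thesis by (simp add: filterlim_at_split)
qed

text \<open>With s = 1/t one has d/dt = - s^2 d/ds, so P(s) exp(-s) is sent to s^2 (P - P')(s)
  exp(-s). The factor \<open>[:0, 0, 1:]\<close> is this s^2.\<close>

lemma exp_cutoff_has_derivative:
  "(exp_cutoff P has_field_derivative exp_cutoff ([:0, 0, 1:] * (P - pderiv P)) t) (at t)"
proof -
  consider "t > 0" | "t = 0" | "t < 0" by linarith
  then show ?thesis
  proof cases
    case 1
    have "((\<lambda>t. poly P (1 / t) * exp (- (1 / t))) has_field_derivative
        exp_cutoff ([:0, 0, 1:] * (P - pderiv P)) t) (at t)"
      using 1 by (auto intro!: derivative_eq_intros poly_DERIV[THEN DERIV_chain2]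
          simp: exp_cutoff_def field_simps power2_eq_square)
    then show ?thesis
      by (rule has_field_derivative_transform_within_open[of _ _ _ "{0<..}"])
        (use 1 in \<open>auto simp: exp_cutoff_def\<close>)
  next
    case 2
    \<comment> \<open>The difference quotient at 0 is again a member of the family: dividing by the
      argument multiplies the polynomial by its variable.\<close>
    have "((\<lambda>s. exp_cutoff P s / s) \<longlongrightarrow> 0) (at 0)"
      by (rule Lim_transform_eventually[OF exp_cutoff_tendsto_0[of "[:0, 1:] * P"]])
        (auto simp: exp_cutoff_def eventually_at_filter field_simps)
    then show ?thesis
      unfolding has_field_derivative_iff using 2 by (simp add: exp_cutoff_def)
  next
    case 3
    have "((\<lambda>t. 0) has_field_derivative exp_cutoff ([:0, 0, 1:] * (P - pderiv P)) t) (at t)"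
      using 3 by (simp add: exp_cutoff_def)
    then show ?thesis
      by (rule has_field_derivative_transform_within_open[of _ _ _ "{..<0}"])
        (use 3 in \<open>auto simp: exp_cutoff_def\<close>)
  qed
qed

lemma smooth_on_exp_cutoff: "smooth_on UNIV (exp_cutoff P)"
  unfolding smooth_on_def
proof
  show "Ck_on k UNIV (exp_cutoff P)" for k
  proof (induction k arbitrary: P)
    case 0
    show ?case
      using DERIV_isCont[OF exp_cutoff_has_derivative]
      by (simp add: continuous_at_imp_continuous_on)
  next
    case (Suc k)
    show ?case
      by (rule Ck_on_SucI[OF _ exp_cutoff_has_derivative[unfolded has_field_derivative_def]])
        (auto intro!: Ck_on_mult Suc.IH Ck_on_const)
  qed
qed

lemma smooth_bump:
  fixes x0 :: "'e::euclidean_space"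
  assumes "0 < r"
  obtains \<psi> :: "'e \<Rightarrow> real"
  where "smooth_on UNIV \<psi>" "\<psi> x0 \<noteq> 0" "\<And>x. x \<notin> cball x0 r \<Longrightarrow> \<psi> x = 0"
proof
  \<comment> \<open>The argument is r^2 - |x - x0|^2, spelled out with sums, products and inner
    products so that the closure rules for smoothness apply directly.\<close>
  let ?\<psi> = "\<lambda>x. exp_cutoff 1 (r * r + (\<Sum>b\<in>Basis. -1 * ((x + - x0) \<bullet> b * ((x + - x0) \<bullet> b))))"
  show "smooth_on UNIV ?\<psi>"
    by (intro smooth_on_compose[OF _ _ _ smooth_on_exp_cutoff] smooth_on_add smooth_on_sum
        smooth_on_mult smooth_on_inner smooth_on_const smooth_on_ident) auto
  show "?\<psi> x0 \<noteq> 0"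
    using assms by (simp add: exp_cutoff_def)
  fix x assume "x \<notin> cball x0 r"
  then have "r < norm (x - x0)" by (simp add: dist_norm norm_minus_commute)
  then have "r\<^sup>2 < (norm (x - x0))\<^sup>2" using assms by (simp add: power_strict_mono)
  also have "\<dots> = (\<Sum>b\<in>Basis. (x - x0) \<bullet> b * ((x - x0) \<bullet> b))"
    by (simp add: power2_norm_eq_inner euclidean_inner[of "x - x0" "x - x0"])
  finally show "?\<psi> x = 0"
    by (simp add: exp_cutoff_def sum_negf power2_eq_square)
qed

section \<open>Smooth functions and tangent vectors on manifolds\<close>

lemma smooth_manifoldD:
  assumes "smooth_manifold A" "(U, c) \<in> A"
  shows "open U" "open (c ` U)" "homeomorphism U (c ` U) c (inv_into U c)"
  using assms unfolding smooth_manifold_def by fast+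

lemma smooth_manifold_transition:
  assumes "smooth_manifold A" "(U, c) \<in> A" "(U', c') \<in> A"
  shows "smooth_on (c ` (U \<inter> U')) (c' \<circ> inv_into U c)"
  using assms unfolding smooth_manifold_def by fast

lemma smooth_manifold_chart_at:
  assumes "smooth_manifold A"
  obtains U c where "(U, c) \<in> A" "p \<in> U"
proof -
  have "p \<in> (\<Union>(U, c)\<in>A. U)" using assms by (simp add: smooth_manifold_def)
  then show ?thesis using that by blast
qed

lemma smooth_funs_const: "smooth_manifold A \<Longrightarrow> (\<lambda>p. a) \<in> smooth_funs A"
  by (auto simp: smooth_funs_def comp_def intro: smooth_on_const dest: smooth_manifoldD)

lemma smooth_funs_add:
  "smooth_manifold A \<Longrightarrow> f \<in> smooth_funs A \<Longrightarrow> h \<in> smooth_funs A \<Longrightarrow> (\<lambda>p. f p + h p) \<in> smooth_funs A"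
  by (fastforce simp: smooth_funs_def comp_def intro: smooth_on_add dest: smooth_manifoldD)

lemma smooth_funs_mult:
  "smooth_manifold A \<Longrightarrow> f \<in> smooth_funs A \<Longrightarrow> h \<in> smooth_funs A \<Longrightarrow> (\<lambda>p. f p * h p) \<in> smooth_funs A"
  by (fastforce simp: smooth_funs_def comp_def intro: smooth_on_mult dest: smooth_manifoldD)

text \<open>The preimage \<open>L\<close> of the compact set \<open>K\<close> is closed because the
  manifold is Hausdorff. In any other chart the domain is therefore the union of two open sets: the
  overlap with \<open>U\<close>, where a transition map is composed with \<open>u\<close>, and the
  complement of \<open>L\<close>, where the function is 0.\<close>

lemma smooth_funs_extend_zero:
  assumes A: "smooth_manifold A" and U: "(U, c) \<in> A"
    and u: "smooth_on (c ` U) u"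
    and K: "compact K" "K \<subseteq> c ` U" "\<And>y. y \<in> c ` U \<Longrightarrow> y \<notin> K \<Longrightarrow> u y = 0"
  shows "(\<lambda>q. if q \<in> U then u (c q) else 0) \<in> smooth_funs A"
  unfolding smooth_funs_def
proof (clarify)
  fix U' c' assume U': "(U', c') \<in> A"
  let ?f = "\<lambda>q. if q \<in> U then u (c q) else 0"
  note cU = smooth_manifoldD[OF A U] and cU' = smooth_manifoldD[OF A U']
  define L where "L = inv_into U c ` K"
  have inv: "inv_into U c (c q) = q" if "q \<in> U" for q
    using cU(3) that by (simp add: homeomorphism_def)
  have inv': "inv_into U' c' (c' q) = q" if "q \<in> U'" for q
    using cU'(3) that by (simp add: homeomorphism_def)
  have "continuous_on K (inv_into U c)"
    using cU(3) K(2) continuous_on_subset homeomorphism_cont2 by blast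
  then have "closed L"
    unfolding L_def using K(1) compact_continuous_image compact_imp_closed by blast
  have LU: "L \<subseteq> U" unfolding L_def using K(2) inv by auto
  have op: "open (c' ` W)" if "open W" "W \<subseteq> U'" for W
  proof -
    have "openin (top_of_set (c' ` U')) (c' ` W)"
      using homeomorphism_imp_open_map[OF cU'(3)] that
      by (metis inf.absorb_iff2 openin_open)
    then show ?thesis using cU'(2) openin_open_trans by blast
  qed
  have o1: "open (c' ` (U' \<inter> U))" and o2: "open (c' ` (U' - L))"
    using op cU(1) cU'(1) \<open>closed L\<close> by (auto intro: open_Diff)
  have "smooth_on (c' ` (U' \<inter> U)) (\<lambda>y. u ((c \<circ> inv_into U' c') y))"
    by (rule smooth_on_compose[OF o1 cU(2) _ u smooth_manifold_transition[OF A U' U]])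
      (auto simp: inv')
  then have s1: "smooth_on (c' ` (U' \<inter> U)) (?f \<circ> inv_into U' c')"
    by (rule smooth_on_cong[OF o1, rotated]) (auto simp: inv')
  have f0: "?f q = 0" if "q \<notin> L" for q
    using that K(3)[of "c q"] inv by (force simp: L_def)
  have s2: "smooth_on (c' ` (U' - L)) (?f \<circ> inv_into U' c')"
  proof (rule smooth_on_cong[OF o2 _ smooth_on_const[OF o2, of 0]])
    fix x assume "x \<in> c' ` (U' - L)"
    then obtain q where "x = c' q" "q \<in> U'" "q \<notin> L" by blast
    then show "0 = (?f \<circ> inv_into U' c') x" using f0[of q] inv'[of q] by (simp split: if_splits)
  qed
  have "c' ` U' = c' ` (U' \<inter> U) \<union> c' ` (U' - L)" using LU by blast
  then show "smooth_on (c' ` U') (?f \<circ> inv_into U' c')"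
    using smooth_on_Un[OF o1 o2 s1 s2] by simp
qed

text \<open>The coordinate fields of a chart around \<open>p\<close>, cut off by a bump function, are dual at \<open>p\<close> to
  the cut-off coordinate functions.\<close>

lemma coordinate_fields:
  fixes A :: "('m::{t2_space, second_countable_topology}, 'e::euclidean_space) atlas"
  assumes A: "smooth_manifold A"
  shows "\<exists>(X :: 'e \<Rightarrow> 'm vfield) (y :: 'e \<Rightarrow> 'm \<Rightarrow> real). range X \<subseteq> vector_fields A \<and>
    range y \<subseteq> smooth_funs A \<and> (\<forall>b\<in>Basis. \<forall>b'\<in>Basis. X b p (y b') = (if b = b' then 1 else 0))"
proof -
  obtain U c where U: "(U, c) \<in> A" "p \<in> U"
    using smooth_manifold_chart_at[OF A] by blast
  note cU = smooth_manifoldD[OF A U(1)]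
  let ?i = "inv_into U c" and ?x0 = "c p"
  have inv: "?i (c q) = q" if "q \<in> U" for q
    using cU(3) that by (simp add: homeomorphism_def)
  obtain r where r: "0 < r" "cball ?x0 r \<subseteq> c ` U"
    using cU(2) U(2) open_contains_cball by blast
  obtain \<psi> :: "'e \<Rightarrow> real" where \<psi>: "smooth_on UNIV \<psi>" "\<psi> ?x0 \<noteq> 0" "\<And>x. x \<notin> cball ?x0 r \<Longrightarrow> \<psi> x = 0"
    using smooth_bump[OF r(1), of "c p"] by blast
  have \<psi>U: "smooth_on (c ` U) \<psi>" using smooth_on_subset[OF \<psi>(1)] by blast
  have ext: "(\<lambda>q. if q \<in> U then \<psi> (c q) * u (c q) else 0) \<in> smooth_funs A" if "smooth_on (c ` U) u" for u
    by (rule smooth_funs_extend_zero[OF A U(1) smooth_on_mult[OF cU(2) \<psi>U that] compact_cball r(2)])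
      (simp add: \<psi>(3))
  \<comment> \<open>The outer default 0 is the normalisation that \<open>tangent_space\<close>
    imposes on non-smooth arguments; the inner one extends the cut-off field beyond the
    chart.\<close>
  define X where "X = (\<lambda>b q f. if f \<in> smooth_funs A then
    (if q \<in> U then \<psi> (c q) * frechet_derivative (f \<circ> ?i) (at (c q)) b else 0) else 0)"
  \<comment> \<open>At the centre the bump enters twice, once through the field \<open>X b\<close>
    and once through the function \<open>y b'\<close>, which the factor
    \<open>1 / (\<psi> ?x0)\<^sup>2\<close> compensates. Since \<open>w b'\<close> vanishes at the
    centre, the derivative of the bump does not contribute.\<close>
  define w where "w = (\<lambda>b' z. 1 / (\<psi> ?x0)\<^sup>2 * ((z + - ?x0) \<bullet> b'))"
  define y where "y = (\<lambda>b' q. if q \<in> U then \<psi> (c q) * w b' (c q) else 0)"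
  have sm: "smooth_on (c ` U) (f \<circ> ?i)" if "f \<in> smooth_funs A" for f
    using that U(1) by (auto simp: smooth_funs_def)
  have dif: "((f \<circ> ?i) has_derivative frechet_derivative (f \<circ> ?i) (at (c q))) (at (c q))"
    if "f \<in> smooth_funs A" "q \<in> U" for f q
    using smooth_on_has_derivative[OF sm[OF that(1)]] that(2) by blast
  have w: "smooth_on (c ` U) (w b')" for b'
    unfolding w_def
    by (intro smooth_on_mult smooth_on_inner smooth_on_add smooth_on_const smooth_on_ident cU(2))
  have X: "X b \<in> vector_fields A" for b
    unfolding vector_fields_def
  proof (intro CollectI conjI allI ballI)
    fix f assume f: "f \<in> smooth_funs A"
    show "(\<lambda>q. X b q f) \<in> smooth_funs A"
      using ext[OF smooth_on_frechet_derivative[OF sm[OF f], of b]] f by (simp add: X_def)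
  next
    fix q
    show "X b q \<in> tangent_space A q"
    proof (cases "q \<in> U")
      case False
      then show ?thesis by (simp add: X_def tangent_space_def)
    next
      case True
      have "frechet_derivative ((\<lambda>x. f x + h x) \<circ> ?i) (at (c q)) b
          = frechet_derivative (f \<circ> ?i) (at (c q)) b + frechet_derivative (h \<circ> ?i) (at (c q)) b"
        if "f \<in> smooth_funs A" "h \<in> smooth_funs A" for f h
        using frechet_derivative_at[OF has_derivative_add[OF dif[OF that(1) True] dif[OF that(2) True]]]
        by (simp add: comp_def fun_eq_iff)
      moreover have "frechet_derivative ((\<lambda>x. a * f x) \<circ> ?i) (at (c q)) b
          = a * frechet_derivative (f \<circ> ?i) (at (c q)) b" if "f \<in> smooth_funs A" for a f
        using frechet_derivative_at[OF has_derivative_mult_right[OF dif[OF that True], of a]]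
        by (simp add: comp_def fun_eq_iff)
      moreover have "frechet_derivative ((\<lambda>x. f x * h x) \<circ> ?i) (at (c q)) b
          = frechet_derivative (f \<circ> ?i) (at (c q)) b * h q + f q * frechet_derivative (h \<circ> ?i) (at (c q)) b"
        if "f \<in> smooth_funs A" "h \<in> smooth_funs A" for f h
        using fun_cong[OF frechet_derivative_at[OF has_derivative_mult[OF dif[OF that(1) True]
                dif[OF that(2) True]]], of b]
        by (simp add: comp_def inv True add.commute)
      ultimately show ?thesis
        using True smooth_funs_add[OF A] smooth_funs_mult[OF A] smooth_funs_const[OF A]
        by (auto simp: tangent_space_def X_def algebra_simps)
    qed
  qed
  have y: "y b' \<in> smooth_funs A" for b'
    unfolding y_def by (rule ext[OF w])
  have "X b p (y b') = (if b = b' then 1 else 0)" if "b \<in> Basis" "b' \<in> Basis" for b b'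
  proof -
    have "((\<lambda>z. \<psi> z * w b' z) has_derivative
        (\<lambda>v. \<psi> ?x0 * (1 / (\<psi> ?x0)\<^sup>2 * (v \<bullet> b')) + frechet_derivative \<psi> (at ?x0) v * w b' ?x0)) (at ?x0)"
      unfolding w_def
      by (intro has_derivative_mult smooth_on_has_derivative[OF \<psi>(1)] has_derivative_mult_right
          has_derivative_inner_left) (auto intro!: derivative_eq_intros)
    then have "((y b' \<circ> ?i) has_derivative
        (\<lambda>v. \<psi> ?x0 * (1 / (\<psi> ?x0)\<^sup>2 * (v \<bullet> b')) + frechet_derivative \<psi> (at ?x0) v * w b' ?x0)) (at ?x0)"
      by (rule has_derivative_transform_within_open[OF _ cU(2)]) (use U(2) in \<open>auto simp: y_def inv\<close>)
    then have "frechet_derivative (y b' \<circ> ?i) (at ?x0) b = 1 / \<psi> ?x0 * (b \<bullet> b')"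
      by (simp add: frechet_derivative_at[symmetric] w_def power2_eq_square)
    then show ?thesis
      using that y \<psi>(2) U(2) by (simp add: X_def inner_Basis)
  qed
  then show ?thesis
    using X y by (intro exI[of _ X] exI[of _ y]) auto
qed

section \<open>Vector fields and the extension of tangent vectors to global fields\<close>

lemma tangent_space_subspace: "subspace (tangent_space A p)"
  unfolding subspace_def tangent_space_def
  by (auto simp: scaleR_fun_def algebra_simps zero_fun_def)

lemma vector_fieldsD:
  assumes "X \<in> vector_fields A"
  shows "X p \<in> tangent_space A p" "f \<in> smooth_funs A \<Longrightarrow> (\<lambda>p. X p f) \<in> smooth_funs A"
  using assms by (simp_all add: vector_fields_def)

lemma vector_fieldsI:
  assumes "\<And>p. X p \<in> tangent_space A p" "\<And>f. f \<in> smooth_funs A \<Longrightarrow> (\<lambda>p. X p f) \<in> smooth_funs A"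
  shows "X \<in> vector_fields A"
  using assms by (simp add: vector_fields_def)

lemma vector_fields_zero: "smooth_manifold A \<Longrightarrow> (\<lambda>p. 0) \<in> vector_fields A"
  using smooth_funs_const[of A 0]
  by (intro vector_fieldsI) (simp_all add: subspace_0[OF tangent_space_subspace])

lemma vector_fields_add:
  assumes "smooth_manifold A" "X \<in> vector_fields A" "Y \<in> vector_fields A"
  shows "(\<lambda>p. X p + Y p) \<in> vector_fields A"
proof (rule vector_fieldsI)
  show "X p + Y p \<in> tangent_space A p" for p
    by (rule subspace_add[OF tangent_space_subspace assms(2,3)[THEN vector_fieldsD(1)]])
  show "(\<lambda>p. (X p + Y p) f) \<in> smooth_funs A" if "f \<in> smooth_funs A" for f
    using smooth_funs_add[OF assms(1) assms(2,3)[THEN vector_fieldsD(2)[OF _ that]]] by simp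
qed

lemma vector_fields_scale:
  assumes "smooth_manifold A" "f \<in> smooth_funs A" "X \<in> vector_fields A"
  shows "(\<lambda>p. f p *\<^sub>R X p) \<in> vector_fields A"
proof (rule vector_fieldsI)
  show "f p *\<^sub>R X p \<in> tangent_space A p" for p
    by (rule subspace_scale[OF tangent_space_subspace vector_fieldsD(1)[OF assms(3)]])
  show "(\<lambda>p. (f p *\<^sub>R X p) h) \<in> smooth_funs A" if "h \<in> smooth_funs A" for h
    using smooth_funs_mult[OF assms(1,2) vector_fieldsD(2)[OF assms(3) that]]
    by (simp add: scaleR_fun_def)
qed

text \<open>The bound on \<open>S\<close> stands in for Hadamard's lemma: the values at
  \<open>p\<close> of the coordinate fields are already \<open>DIM('e)\<close> independent vectors,
  so no derivation at \<open>p\<close> can lie outside their span. The values at \<open>p\<close> of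
  global fields form a subspace containing them.\<close>

lemma tangent_extension:
  fixes A :: "('m::{t2_space, second_countable_topology}, 'e::euclidean_space) atlas"
  assumes A: "smooth_manifold A"
    and S: "finite S" "card S \<le> DIM('e)" "tangent_space A p \<subseteq> span S"
    and v: "v \<in> tangent_space A p"
  obtains X where "X \<in> vector_fields A" "X p = v"
proof -
  obtain X :: "'e \<Rightarrow> 'm vfield" and y :: "'e \<Rightarrow> 'm \<Rightarrow> real" where
    Xy: "range X \<subseteq> vector_fields A \<and> range y \<subseteq> smooth_funs A \<and>
      (\<forall>b\<in>Basis. \<forall>b'\<in>Basis. X b p (y b') = (if b = b' then 1 else 0))"
    using coordinate_fields[OF A, of p] by (elim exE)
  then have X: "X b \<in> vector_fields A" for b by auto
  have d: "X b p (y b') = (if b = b' then 1 else 0)" if "b \<in> Basis" "b' \<in> Basis" for b b'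
    using Xy that by simp
  let ?V = "{X p | X. X \<in> vector_fields A}" and ?I = "(\<lambda>b. X b p) ` Basis"
  have XT: "X b p \<in> tangent_space A p" for b using X by (auto simp: vector_fields_def)
  have inj: "inj_on (\<lambda>b. X b p) Basis"
    using d by (intro inj_onI) (metis zero_neq_one)
  have sum_eval: "(\<Sum>b\<in>Basis. a b *\<^sub>R X b p) f = (\<Sum>b\<in>Basis. a b * X b p f)" for a f
    by (induction rule: finite_induct[OF finite_Basis]) (simp_all add: scaleR_fun_def)
  have "independent ?I"
  proof
    assume "dependent ?I"
    then obtain u w where 0: "(\<Sum>w\<in>?I. u w *\<^sub>R w) = 0" and w: "w \<in> ?I" "u w \<noteq> 0"
      unfolding dependent_finite[OF finite_imageI[OF finite_Basis]] by auto
    from w(1) obtain b where b: "b \<in> Basis" "w = X b p" by auto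
    have "(\<Sum>b\<in>Basis. u (X b p) *\<^sub>R X b p) = 0"
      using 0 by (simp add: sum.reindex[OF inj])
    then have e1: "(\<Sum>b'\<in>Basis. u (X b' p) * X b' p (y b)) = 0"
      using sum_eval[of "\<lambda>b. u (X b p)" "y b"] by simp
    have e2: "(\<Sum>b'\<in>Basis. u (X b' p) * X b' p (y b)) = (\<Sum>b'\<in>Basis. if b' = b then u (X b p) else 0)"
      using b(1) by (intro sum.cong) (simp_all add: d)
    have e3: "(\<Sum>b'\<in>Basis. if b' = b then u (X b p) else 0) = u w"
      unfolding b(2) using b(1) by (subst sum.delta) simp_all
    show False using e1 e2 e3 w(2) by metis
  qed
  have "v \<in> span ?I"
  proof (rule ccontr)
    assume nv: "v \<notin> span ?I"
    then have "independent (insert v ?I)" using \<open>independent ?I\<close> independent_insertI by blast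
    moreover have "insert v ?I \<subseteq> span S" using v XT S(3) by auto
    ultimately have "card (insert v ?I) \<le> card S" using S(1) independent_span_bound by blast
    moreover have "card (insert v ?I) = DIM('e) + 1"
      using nv span_superset[of ?I] by (subst card_insert_disjoint) (auto simp: card_image[OF inj])
    ultimately show False using S(2) by simp
  qed
  moreover have "subspace ?V"
    unfolding subspace_def
  proof (safe)
    show "\<exists>X. 0 = X p \<and> X \<in> vector_fields A"
      using vector_fields_zero[OF A] by (intro exI[of _ "\<lambda>p. 0"]) simp
    show "\<exists>Z. X p + Y p = Z p \<and> Z \<in> vector_fields A"
      if "X \<in> vector_fields A" "Y \<in> vector_fields A" for X Y
      using vector_fields_add[OF A that] by (intro exI[of _ "\<lambda>p. X p + Y p"]) simp
    show "\<exists>Z. a *\<^sub>R X p = Z p \<and> Z \<in> vector_fields A" if "X \<in> vector_fields A" for a X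
      using vector_fields_scale[OF A smooth_funs_const[OF A] that]
      by (intro exI[of _ "\<lambda>p. a *\<^sub>R X p"]) simp
  qed
  moreover have "?I \<subseteq> ?V" using X by auto
  ultimately have "v \<in> ?V"
    using span_minimal[of ?I ?V] by auto
  then show ?thesis using that by auto
qed

text \<open>By \<open>rep\<close> the sum of the tensors of \<open>e i\<close> with
  \<open>\<theta> i\<close> is the identity. The trace of \<open>L\<close> composed with it, written
  in the basis chosen inside \<open>trace_over\<close>, becomes the right-hand side after the two
  sums are exchanged.\<close>

lemma trace_over_frame:
  assumes W: "subspace W" and L: "linear_over W L" "L ` W \<subseteq> W"
    and I: "finite I" "\<And>i. i \<in> I \<Longrightarrow> e i \<in> W"
    and rep: "\<And>v. v \<in> W \<Longrightarrow> v = (\<Sum>i\<in>I. \<theta> i v *\<^sub>R e i)"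
    and lin: "\<And>i. i \<in> I \<Longrightarrow> linear_over W (\<theta> i)"
  shows "trace_over W L = (\<Sum>i\<in>I. \<theta> i (L (e i)))"
proof -
  have lin_sum: "F (\<Sum>i\<in>J. a i *\<^sub>R v i) = (\<Sum>i\<in>J. a i *\<^sub>R F (v i))"
    if F: "linear_over W F" and J: "\<And>i. i \<in> J \<Longrightarrow> v i \<in> W"
    for F :: "'a \<Rightarrow> 'c::real_vector" and J :: "'d set" and a v
    using J
  proof (induction J rule: infinite_finite_induct)
    case (insert i J)
    then have "(\<Sum>i\<in>J. a i *\<^sub>R v i) \<in> W" "a i *\<^sub>R v i \<in> W"
      using W by (auto intro: subspace_sum subspace_scale)
    then show ?case using insert F by (simp add: linear_over_def)
  qed (use F subspace_0[OF W] in \<open>force simp: linear_over_def\<close>)+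
  define B where "B = (SOME B. independent B \<and> span B = W)"
  have "\<exists>B. independent B \<and> span B = W"
    using basis_exists[of W] span_subspace[OF _ _ W] by metis
  then have B: "independent B" "span B = W"
    unfolding B_def by (rule someI2_ex; blast)+
  have "W \<subseteq> span (e ` I)"
    using rep by (metis (no_types, lifting) imageI span_base span_scale span_sum subsetI)
  then have "finite B"
    using B I(1) independent_span_bound[of "e ` I" B] span_superset by blast
  have BW: "b \<in> W" if "b \<in> B" for b using that B span_base by blast
  have LW: "L (e i) \<in> W" if "i \<in> I" for i using that I(2) L(2) by blast
  have "representation B (L b) b = (\<Sum>i\<in>I. \<theta> i b * representation B (L (e i)) b)" if b: "b \<in> B" for b
  proof -
    have "L b = (\<Sum>i\<in>I. \<theta> i b *\<^sub>R L (e i))"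
      using rep[OF BW[OF b]] lin_sum[OF L(1), of I e] I(2) by metis
    then show ?thesis
      using LW B by (simp add: representation_sum representation_scale subspace_scale W)
  qed
  then have "(\<Sum>b\<in>B. representation B (L b) b)
      = (\<Sum>i\<in>I. \<Sum>b\<in>B. representation B (L (e i)) b * \<theta> i b)"
    by (subst sum.swap) (simp add: mult.commute)
  also have "\<dots> = (\<Sum>i\<in>I. \<theta> i (\<Sum>b\<in>B. representation B (L (e i)) b *\<^sub>R b))"
    using lin_sum[OF lin, of _ B] BW by simp
  also have "\<dots> = (\<Sum>i\<in>I. \<theta> i (L (e i)))"
    using LW B \<open>finite B\<close> by (intro sum.cong) (simp_all add: sum_representation_eq)
  finally show ?thesis by (simp add: trace_over_def B_def)
qed

section \<open>Levi-Civita connections as operators on vector fields\<close>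

text \<open>Fields become a module over functions, so that whole identities can be scaled by a
  function or differentiated without naming a point.\<close>

definition fscale :: "('m \<Rightarrow> real) \<Rightarrow> 'm vfield \<Rightarrow> 'm vfield" (infixr "\<odot>" 75) where
  "f \<odot> X = (\<lambda>p. f p *\<^sub>R X p)"

definition lie_fun :: "'m vfield \<Rightarrow> ('m \<Rightarrow> real) \<Rightarrow> 'm \<Rightarrow> real" (infixr "\<rhd>" 75) where
  "X \<rhd> f = (\<lambda>p. X p f)"

lemma fscale_simps:
  "(f + h) \<odot> X = f \<odot> X + h \<odot> X"
  "(f - h) \<odot> X = f \<odot> X - h \<odot> X"
  "(- f) \<odot> X = - (f \<odot> X)"
  "f \<odot> (X + Y) = f \<odot> X + f \<odot> Y"
  "f \<odot> (X - Y) = f \<odot> X - f \<odot> Y"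
  "f \<odot> (- X) = - (f \<odot> X)"
  "f \<odot> h \<odot> X = (f * h) \<odot> X"
  by (rule ext, simp add: fscale_def scaleR_left_distrib scaleR_right_distrib
      scaleR_left_diff_distrib scaleR_right_diff_distrib)+

lemma fscale_trivial [simp]: "1 \<odot> X = X" "0 \<odot> X = 0" "f \<odot> 0 = 0"
  by (rule ext, simp add: fscale_def)+

lemma fscale_apply: "(f \<odot> X) p = f p *\<^sub>R X p"
  by (simp add: fscale_def)

lemma lie_fun_field_simps:
  "0 \<rhd> f = 0" "(X + Y) \<rhd> f = X \<rhd> f + Y \<rhd> f" "(X - Y) \<rhd> f = X \<rhd> f - Y \<rhd> f"
  "(- X) \<rhd> f = - (X \<rhd> f)" "(h \<odot> X) \<rhd> f = h * (X \<rhd> f)"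
  by (rule ext, simp add: lie_fun_def fscale_def scaleR_fun_def)+

locale levi_civita_manifold =
  fixes A :: "('m::{t2_space, second_countable_topology}, 'e::euclidean_space) atlas"
    and g :: "'m two_tensor" and D :: "'m connection"
  assumes manifold: "smooth_manifold A"
    and metric: "semi_riemannian_metric A g"
    and levi_civita: "levi_civita A g D"
begin

abbreviation "\<XX> \<equiv> vector_fields A"
abbreviation "\<FF> \<equiv> smooth_funs A"
abbreviation "R \<equiv> curvature D"

definition G :: "'m vfield \<Rightarrow> 'm vfield \<Rightarrow> 'm \<Rightarrow> real" where
  "G X Y = (\<lambda>p. g p (X p) (Y p))"

lemma tangent [simp]: "X \<in> \<XX> \<Longrightarrow> X p \<in> tangent_space A p"
  by (rule vector_fieldsD)

lemma smooth_fun_closed [simp]: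
  "0 \<in> \<FF>" "1 \<in> \<FF>" "f \<in> \<FF> \<Longrightarrow> h \<in> \<FF> \<Longrightarrow> f + h \<in> \<FF>" "f \<in> \<FF> \<Longrightarrow> h \<in> \<FF> \<Longrightarrow> f * h \<in> \<FF>"
  "X \<in> \<XX> \<Longrightarrow> f \<in> \<FF> \<Longrightarrow> X \<rhd> f \<in> \<FF>"
  using smooth_funs_const[OF manifold, of 0] smooth_funs_const[OF manifold, of 1]
    smooth_funs_add[OF manifold] smooth_funs_mult[OF manifold] vector_fieldsD(2)
  by (simp_all add: zero_fun_def one_fun_def plus_fun_def times_fun_def lie_fun_def)

lemma smooth_fun_numeral [simp]: "numeral n \<in> \<FF>"
  by (induction n) (simp_all only: numeral.simps smooth_fun_closed)

lemma smooth_fun_uminus [simp]: "f \<in> \<FF> \<Longrightarrow> - f \<in> \<FF>"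
  using smooth_funs_mult[OF manifold smooth_funs_const[OF manifold, of "-1"]]
  by (simp add: fun_Compl_def)

lemma smooth_fun_diff [simp]: "f \<in> \<FF> \<Longrightarrow> h \<in> \<FF> \<Longrightarrow> f - h \<in> \<FF>"
  using smooth_fun_closed(3)[of f "- h"] by simp

lemma field_closed [simp]:
  "0 \<in> \<XX>" "X \<in> \<XX> \<Longrightarrow> Y \<in> \<XX> \<Longrightarrow> X + Y \<in> \<XX>" "f \<in> \<FF> \<Longrightarrow> X \<in> \<XX> \<Longrightarrow> f \<odot> X \<in> \<XX>"
  using vector_fields_zero[OF manifold] vector_fields_add[OF manifold] vector_fields_scale[OF manifold]
  by (simp_all add: zero_fun_def plus_fun_def fscale_def)

lemma field_uminus [simp]: "X \<in> \<XX> \<Longrightarrow> - X \<in> \<XX>"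
  using field_closed(3)[of "- 1" X] by (simp add: fscale_simps)

lemma field_diff [simp]: "X \<in> \<XX> \<Longrightarrow> Y \<in> \<XX> \<Longrightarrow> X - Y \<in> \<XX>"
  using field_closed(2)[of X "- Y"] by simp

lemma lie_fun_add: "X \<in> \<XX> \<Longrightarrow> f \<in> \<FF> \<Longrightarrow> h \<in> \<FF> \<Longrightarrow> X \<rhd> (f + h) = X \<rhd> f + X \<rhd> h"
  using vector_fieldsD(1)[of X A]
  by (intro ext) (simp add: lie_fun_def plus_fun_def tangent_space_def)

lemma lie_fun_mult: "X \<in> \<XX> \<Longrightarrow> f \<in> \<FF> \<Longrightarrow> h \<in> \<FF> \<Longrightarrow> X \<rhd> (f * h) = (X \<rhd> f) * h + f * (X \<rhd> h)"
  using vector_fieldsD(1)[of X A]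
  by (intro ext) (simp add: lie_fun_def times_fun_def tangent_space_def)

lemma lie_fun_cmult: "X \<in> \<XX> \<Longrightarrow> f \<in> \<FF> \<Longrightarrow> X p (\<lambda>q. a * f q) = a * X p f"
  using vector_fieldsD(1)[of X A p] by (simp add: tangent_space_def)

lemma lie_fun_nonsmooth: "X \<in> \<XX> \<Longrightarrow> f \<notin> \<FF> \<Longrightarrow> X p f = 0"
  using vector_fieldsD(1)[of X A p] by (simp add: tangent_space_def)

lemma lie_fun_zero [simp]: "X \<in> \<XX> \<Longrightarrow> X \<rhd> 0 = 0"
  using lie_fun_add[of X 0 0] by simp

lemma lie_fun_one [simp]: "X \<in> \<XX> \<Longrightarrow> X \<rhd> 1 = 0"
  using lie_fun_mult[of X 1 1] by simp

lemma lie_fun_uminus: "X \<in> \<XX> \<Longrightarrow> f \<in> \<FF> \<Longrightarrow> X \<rhd> (- f) = - (X \<rhd> f)"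
  using lie_fun_add[of X f "- f"] by (simp add: eq_neg_iff_add_eq_0 add.commute)

lemma lie_fun_diff: "X \<in> \<XX> \<Longrightarrow> f \<in> \<FF> \<Longrightarrow> h \<in> \<FF> \<Longrightarrow> X \<rhd> (f - h) = X \<rhd> f - X \<rhd> h"
  using lie_fun_add[of X f "- h"] by (simp add: lie_fun_uminus)

lemma lie_fun_const [simp]: "X \<in> \<XX> \<Longrightarrow> X p (\<lambda>q. a) = 0"
  using lie_fun_cmult[of X 1 p a] fun_cong[OF lie_fun_one[of X], of p]
  by (simp add: lie_fun_def)

lemma connection_closed [simp]: "X \<in> \<XX> \<Longrightarrow> Y \<in> \<XX> \<Longrightarrow> D X Y \<in> \<XX>"
  using levi_civita by (simp add: levi_civita_def affine_connection_def)

lemma connection_add: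
  assumes "X \<in> \<XX>" "Y \<in> \<XX>" "Z \<in> \<XX>"
  shows "D (X + Y) Z = D X Z + D Y Z" "D X (Y + Z) = D X Y + D X Z"
  using levi_civita assms
  by (simp_all add: levi_civita_def affine_connection_def plus_fun_def)

lemma connection_scale:
  assumes "X \<in> \<XX>" "Y \<in> \<XX>" "f \<in> \<FF>"
  shows "D (f \<odot> X) Y = f \<odot> D X Y" "D X (f \<odot> Y) = (X \<rhd> f) \<odot> Y + f \<odot> D X Y"
  using levi_civita assms
  by (simp_all add: levi_civita_def affine_connection_def plus_fun_def fscale_def lie_fun_def)

lemmas connection_simps = connection_add connection_scale

lemma connection_zero [simp]: "X \<in> \<XX> \<Longrightarrow> D 0 X = 0" "X \<in> \<XX> \<Longrightarrow> D X 0 = 0"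
  using connection_simps(3)[of X X 0] connection_simps(2)[of X 0 0] by simp_all

lemma connection_uminus:
  assumes "X \<in> \<XX>" "Y \<in> \<XX>"
  shows "D (- X) Y = - D X Y" "D X (- Y) = - D X Y"
  using connection_simps(1)[of X "- X" Y] connection_simps(2)[of X Y "- Y"] assms
  by (simp_all add: eq_neg_iff_add_eq_0 add.commute)

lemma connection_diff:
  assumes "X \<in> \<XX>" "Y \<in> \<XX>" "Z \<in> \<XX>"
  shows "D (X - Y) Z = D X Z - D Y Z" "D X (Y - Z) = D X Y - D X Z"
  using connection_simps(1)[of X "- Y" Z] connection_simps(2)[of X Y "- Z"] connection_uminus assms
  by simp_all

lemma lie_bracket_eq: "X \<in> \<XX> \<Longrightarrow> Y \<in> \<XX> \<Longrightarrow> lie_bracket X Y = D X Y - D Y X"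
  using levi_civita by (simp add: levi_civita_def fun_diff_def)

text \<open>Torsion-freeness of \<open>D\<close> replaces the check that a commutator of derivations
  is a derivation.\<close>

lemma lie_bracket_closed [simp]: "X \<in> \<XX> \<Longrightarrow> Y \<in> \<XX> \<Longrightarrow> lie_bracket X Y \<in> \<XX>"
  by (simp add: lie_bracket_eq)

lemma lie_bracket_fun: "lie_bracket X Y \<rhd> f = X \<rhd> Y \<rhd> f - Y \<rhd> X \<rhd> f"
  by (simp add: lie_fun_def lie_bracket_def fun_diff_def)

lemma lie_bracket_anti: "X \<in> \<XX> \<Longrightarrow> Y \<in> \<XX> \<Longrightarrow> lie_bracket Y X = - lie_bracket X Y"
  by (simp add: lie_bracket_eq)

text \<open>Testing on smooth functions suffices for equality of HOL functions because tangent
  vectors are normalised to 0 on all others.\<close>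

lemma field_eqI:
  assumes "X \<in> \<XX>" "Y \<in> \<XX>" "\<And>f. f \<in> \<FF> \<Longrightarrow> X \<rhd> f = Y \<rhd> f"
  shows "X = Y"
proof (rule ext)+
  fix p f
  show "X p f = Y p f"
  proof (cases "f \<in> \<FF>")
    case True
    then show ?thesis using fun_cong[OF assms(3), of f p] by (simp add: lie_fun_def)
  next
    case False
    then show ?thesis by (simp add: lie_fun_nonsmooth assms(1,2))
  qed
qed

lemma jacobi:
  assumes "X \<in> \<XX>" "Y \<in> \<XX>" "Z \<in> \<XX>"
  shows "lie_bracket (lie_bracket X Y) Z + lie_bracket (lie_bracket Y Z) X
    + lie_bracket (lie_bracket Z X) Y = 0"
  by (rule field_eqI)
    (simp_all add: assms lie_fun_field_simps lie_bracket_fun lie_fun_diff)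

lemma metric_closed [simp]: "X \<in> \<XX> \<Longrightarrow> Y \<in> \<XX> \<Longrightarrow> G X Y \<in> \<FF>"
  using metric by (simp add: semi_riemannian_metric_def smooth_two_tensor_def G_def)

lemma metric_commute: "X \<in> \<XX> \<Longrightarrow> Y \<in> \<XX> \<Longrightarrow> G X Y = G Y X"
  using metric by (intro ext) (simp add: semi_riemannian_metric_def G_def)

lemma metric_linear:
  "linear_over (tangent_space A p) (g p u)" "linear_over (tangent_space A p) (\<lambda>v. g p v u)"
  if "u \<in> tangent_space A p"
  using metric that by (simp_all add: semi_riemannian_metric_def smooth_two_tensor_def)

lemma metric_nondegenerate:
  "u \<in> tangent_space A p \<Longrightarrow> (\<And>v. v \<in> tangent_space A p \<Longrightarrow> g p u v = 0) \<Longrightarrow> u = 0"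
  using metric by (simp add: semi_riemannian_metric_def)

lemma metric_add:
  assumes "X \<in> \<XX>" "Y \<in> \<XX>" "Z \<in> \<XX>"
  shows "G (X + Y) Z = G X Z + G Y Z" "G X (Y + Z) = G X Y + G X Z"
  using metric_linear assms by (intro ext; simp add: G_def linear_over_def)+

lemma metric_scale:
  assumes "X \<in> \<XX>" "Y \<in> \<XX>"
  shows "G (f \<odot> X) Y = f * G X Y" "G X (f \<odot> Y) = f * G X Y"
  using metric_linear assms by (intro ext; simp add: G_def linear_over_def fscale_def)+

lemmas metric_simps = metric_add metric_scale

lemma metric_zero [simp]: "X \<in> \<XX> \<Longrightarrow> G 0 X = 0" "X \<in> \<XX> \<Longrightarrow> G X 0 = 0"
  using metric_simps(3)[of X X 0] metric_simps(4)[of X X 0] by simp_all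

lemma metric_uminus:
  assumes "X \<in> \<XX>" "Y \<in> \<XX>"
  shows "G (- X) Y = - G X Y" "G X (- Y) = - G X Y"
  using metric_simps(3)[of X Y "- 1"] metric_simps(4)[of X Y "- 1"] assms
  by (simp_all add: fscale_simps)

lemma metric_diff:
  assumes "X \<in> \<XX>" "Y \<in> \<XX>" "Z \<in> \<XX>"
  shows "G (X - Y) Z = G X Z - G Y Z" "G X (Y - Z) = G X Y - G X Z"
  using metric_simps(1)[of X "- Y" Z] metric_simps(2)[of X Y "- Z"] metric_uminus assms
  by simp_all

lemma metric_compatible:
  assumes "X \<in> \<XX>" "Y \<in> \<XX>" "Z \<in> \<XX>"
  shows "X \<rhd> G Y Z = G (D X Y) Z + G Y (D X Z)"
  using levi_civita assms by (intro ext) (simp add: levi_civita_def lie_fun_def G_def)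

section \<open>The curvature operator and its symmetries\<close>

lemma curvature_eq: "R X Y Z = D X (D Y Z) - D Y (D X Z) - D (lie_bracket X Y) Z"
  by (simp add: curvature_def fun_diff_def)

lemma curvature_closed [simp]: "X \<in> \<XX> \<Longrightarrow> Y \<in> \<XX> \<Longrightarrow> Z \<in> \<XX> \<Longrightarrow> R X Y Z \<in> \<XX>"
  by (simp add: curvature_eq)

lemma curvature_anti: "X \<in> \<XX> \<Longrightarrow> Y \<in> \<XX> \<Longrightarrow> Z \<in> \<XX> \<Longrightarrow> R Y X Z = - R X Y Z"
  by (simp add: curvature_eq lie_bracket_eq connection_diff)

lemma curvature_add:
  assumes "X \<in> \<XX>" "X' \<in> \<XX>" "Y \<in> \<XX>" "Z \<in> \<XX>"
  shows "R (X + X') Y Z = R X Y Z + R X' Y Z" "R Y (X + X') Z = R Y X Z + R Y X' Z"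
    "R Y Z (X + X') = R Y Z X + R Y Z X'"
  using assms by (simp_all add: curvature_eq lie_bracket_eq connection_simps connection_diff)

lemma curvature_scale:
  assumes "f \<in> \<FF>" "X \<in> \<XX>" "Y \<in> \<XX>" "Z \<in> \<XX>"
  shows "R (f \<odot> X) Y Z = f \<odot> R X Y Z" "R Y (f \<odot> X) Z = f \<odot> R Y X Z"
    "R Y Z (f \<odot> X) = f \<odot> R Y Z X"
proof -
  show 1: "R (f \<odot> X) Y Z = f \<odot> R X Y Z"
    using assms by (simp add: curvature_eq lie_bracket_eq connection_simps connection_diff fscale_simps)
  show "R Y (f \<odot> X) Z = f \<odot> R Y X Z"
    using 1 assms curvature_anti[of "f \<odot> X" Y Z] curvature_anti[of X Y Z] by (simp add: fscale_simps)
  \<comment> \<open>This cancels the second derivatives of \<open>f\<close> that the Leibniz rule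
    produces in the third slot.\<close>
  have "(D Y Z - D Z Y) \<rhd> f = Y \<rhd> Z \<rhd> f - Z \<rhd> Y \<rhd> f"
    using assms lie_bracket_fun[of Y Z f] by (simp add: lie_bracket_eq)
  then show "R Y Z (f \<odot> X) = f \<odot> R Y Z X"
    using assms by (simp add: curvature_eq lie_bracket_eq connection_simps connection_diff fscale_simps)
qed

lemma curvature_skew:
  assumes "X \<in> \<XX>" "Y \<in> \<XX>" "Z \<in> \<XX>" "W \<in> \<XX>"
  shows "G (R X Y Z) W = - G Z (R X Y W)"
proof -
  \<comment> \<open>Metric compatibility, applied twice, turns this trivial identity for the
    function \<open>G Z W\<close> into skewness of the curvature.\<close>
  have "lie_bracket X Y \<rhd> G Z W = X \<rhd> Y \<rhd> G Z W - Y \<rhd> X \<rhd> G Z W"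
    by (rule lie_bracket_fun)
  then have "G (R X Y Z) W + G Z (R X Y W) = 0"
    using assms by (simp add: curvature_eq metric_simps metric_diff metric_compatible lie_fun_add algebra_simps)
  then show ?thesis by (simp add: eq_neg_iff_add_eq_0)
qed

lemma bianchi_first:
  assumes "X \<in> \<XX>" "Y \<in> \<XX>" "Z \<in> \<XX>"
  shows "R X Y Z + R Y Z X + R Z X Y = 0"
  using jacobi[OF assms] assms
  by (simp add: curvature_eq lie_bracket_eq connection_diff algebra_simps)

lemma curvature_pair_symmetric:
  assumes "X \<in> \<XX>" "Y \<in> \<XX>" "Z \<in> \<XX>" "W \<in> \<XX>"
  shows "G (R X Y Z) W = G (R Z W X) Y"
proof (rule ext)
  fix p
  define K where "K a b c d = G (R a b c) d p" for a b c d
  have b: "K a b c d + K b c a d + K c a b d = 0"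
    if "a \<in> \<XX>" "b \<in> \<XX>" "c \<in> \<XX>" "d \<in> \<XX>" for a b c d
    using fun_cong[OF arg_cong[OF bianchi_first[OF that(1,2,3)], of "\<lambda>V. G V d"], of p] that
    by (simp add: K_def metric_simps)
  have s: "K a b c d = - K b a c d"
    if "a \<in> \<XX>" "b \<in> \<XX>" "c \<in> \<XX>" "d \<in> \<XX>" for a b c d
    using curvature_anti[OF that(2,1,3)] that by (simp add: K_def metric_uminus)
  have t: "K a b c d = - K a b d c"
    if "a \<in> \<XX>" "b \<in> \<XX>" "c \<in> \<XX>" "d \<in> \<XX>" for a b c d
    using curvature_skew[OF that] metric_commute[of c "R a b d"] that by (simp add: K_def)
  \<comment> \<open>Milnor's octahedron argument: combine the first Bianchi identity for the four
    cyclic rotations of the arguments and match the terms by the two skew symmetries.\<close>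
  have "K X Y Z W = K Z W X Y"
    using b[OF assms] b[OF assms(2,3,4,1)] b[OF assms(3,4,1,2)] b[OF assms(4,1,2,3)]
      t[OF assms] t[OF assms(2,3,1,4)] s[OF assms(3,1,2,4)] t[OF assms(1,3,2,4)]
      t[OF assms(3,4,2,1)] s[OF assms(4,2,3,1)] t[OF assms(2,4,3,1)] t[OF assms(4,1,3,2)]
    by linarith
  then show "G (R X Y Z) W p = G (R Z W X) Y p" by (simp add: K_def)
qed

text \<open>Written with commutators of operators on fields, which avoids covariant derivatives of
  the curvature tensor. In the cyclic sum the triple commutators of \<open>D X\<close>,
  \<open>D Y\<close>, \<open>D Z\<close> cancel by the Jacobi identity for operators. What remains
  are curvatures with a bracket in one slot and \<open>D\<close> along double brackets, and the
  latter vanish by \<open>jacobi\<close>.\<close>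

lemma bianchi_second:
  assumes "X \<in> \<XX>" "Y \<in> \<XX>" "Z \<in> \<XX>" "W \<in> \<XX>"
  shows "D X (R Y Z W) - R Y Z (D X W) + (D Y (R Z X W) - R Z X (D Y W))
      + (D Z (R X Y W) - R X Y (D Z W))
    = R (lie_bracket X Y) Z W + R (lie_bracket Y Z) X W + R (lie_bracket Z X) Y W"
proof -
  have "D (lie_bracket (lie_bracket X Y) Z + lie_bracket (lie_bracket Y Z) X
      + lie_bracket (lie_bracket Z X) Y) W = 0"
    using assms by (simp add: jacobi)
  then have "D (lie_bracket (lie_bracket X Y) Z) W + D (lie_bracket (lie_bracket Y Z) X) W
      + D (lie_bracket (lie_bracket Z X) Y) W = 0"
    using assms by (simp add: connection_simps)
  then show ?thesis
    using assms by (simp add: curvature_eq connection_simps connection_diff algebra_simps)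
qed

end

section \<open>Para-Kenmotsu manifolds\<close>

lemma linear_overD:
  assumes "linear_over W L" "u \<in> W" "v \<in> W"
  shows "L (u + v) = L u + L v" "L (a *\<^sub>R v) = a *\<^sub>R L v"
  using assms by (auto simp: linear_over_def)

lemma linear_over_simps:
  assumes "subspace W" "linear_over W L" "u \<in> W" "v \<in> W"
  shows "L 0 = 0" "L (- v) = - L v" "L (u - v) = L u - L v"
proof -
  show "L 0 = 0" using linear_overD(2)[OF assms(2,3,3), of 0] by simp
  show 1: "L (- v) = - L v" using linear_overD(2)[OF assms(2,3,4), of "-1"] by simp
  show "L (u - v) = L u - L v"
    using linear_overD(1)[OF assms(2,3) subspace_neg[OF assms(1,4)]] 1 by simp
qed

lemma dim_one_subspace:
  assumes "subspace W" "dim W = 1"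
  shows "\<exists>e\<in>W. e \<noteq> 0 \<and> (\<forall>v\<in>W. \<exists>a. v = a *\<^sub>R e)"
proof -
  obtain B where B: "B \<subseteq> W" "independent B" "W \<subseteq> span B" "card B = dim W"
    using basis_exists by blast
  then obtain e where e: "B = {e}" using assms(2) by (auto simp: card_1_singleton_iff)
  have "e \<noteq> 0" "e \<in> W" using B dependent_zero unfolding e by auto
  moreover have "\<exists>a. v = a *\<^sub>R e" if "v \<in> W" for v
    using B(3) that unfolding e by (auto simp: span_singleton)
  ultimately show ?thesis by blast
qed

lemma double_cancel: "x + x = y + y \<Longrightarrow> x = y" for x y :: "'a::real_vector"
  by (metis scaleR_2 scaleR_cancel_left zero_neq_numeral)

lemma eq_uminus_imp_zero: "x = - x \<Longrightarrow> x = 0" for x :: "'a::real_vector"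
  using double_cancel[of x 0] by (simp add: eq_neg_iff_add_eq_0)

locale para_kenmotsu_manifold = levi_civita_manifold A g D
  for A :: "('m::{t2_space, second_countable_topology}, 'e::euclidean_space) atlas"
    and g :: "'m two_tensor" and D :: "'m connection" +
  fixes \<phi> :: "'m endo_field" and \<xi> :: "'m vfield" and \<eta> :: "'m one_form"
  assumes para_kenmotsu: "para_kenmotsu A \<phi> \<xi> \<eta> g" and dim3: "DIM('e) = 3"
begin

abbreviation "T \<equiv> tangent_space A"

definition Phi :: "'m vfield \<Rightarrow> 'm vfield" where "Phi X = (\<lambda>p. \<phi> p (X p))"

definition Eta :: "'m vfield \<Rightarrow> 'm \<Rightarrow> real" where "Eta X = (\<lambda>p. \<eta> p (X p))"

lemma paracontact_facts:
  shows xi_closed [simp]: "\<xi> \<in> \<XX>"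
    and phi_linear: "linear_over (T p) (\<phi> p)" and eta_linear: "linear_over (T p) (\<eta> p)"
    and phi_tangent: "v \<in> T p \<Longrightarrow> \<phi> p v \<in> T p"
    and eta_xi: "\<eta> p (\<xi> p) = 1"
    and phi_phi: "v \<in> T p \<Longrightarrow> \<phi> p (\<phi> p v) = v - \<eta> p v *\<^sub>R \<xi> p"
    and phi_metric: "u \<in> T p \<Longrightarrow> v \<in> T p \<Longrightarrow> g p (\<phi> p u) (\<phi> p v) = - g p u v + \<eta> p u * \<eta> p v"
    and Phi_closed [simp]: "X \<in> \<XX> \<Longrightarrow> Phi X \<in> \<XX>"
    and Eta_closed [simp]: "X \<in> \<XX> \<Longrightarrow> Eta X \<in> \<FF>"
    and dim_eigenspaces: "dim {v \<in> T p. \<eta> p v = 0 \<and> \<phi> p v = v} = 1"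
      "dim {v \<in> T p. \<eta> p v = 0 \<and> \<phi> p v = - v} = 1"
  using para_kenmotsu dim3
  unfolding para_kenmotsu_def almost_paracontact_metric_def almost_paracontact_def
    smooth_endo_field_def smooth_one_form_def Phi_def Eta_def
  by (simp_all add: image_subset_iff)

lemmas T_simps = subspace_0[OF tangent_space_subspace] subspace_add[OF tangent_space_subspace]
  subspace_scale[OF tangent_space_subspace] subspace_diff[OF tangent_space_subspace]
  subspace_neg[OF tangent_space_subspace]

lemma phi_simps:
  assumes "u \<in> T p" "v \<in> T p"
  shows "\<phi> p 0 = 0" "\<phi> p (u + v) = \<phi> p u + \<phi> p v" "\<phi> p (u - v) = \<phi> p u - \<phi> p v"
    "\<phi> p (- v) = - \<phi> p v" "\<phi> p (a *\<^sub>R v) = a *\<^sub>R \<phi> p v"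
  using linear_overD[OF phi_linear assms] linear_over_simps[OF tangent_space_subspace phi_linear assms]
  by auto

lemma eta_simps:
  assumes "u \<in> T p" "v \<in> T p"
  shows "\<eta> p 0 = 0" "\<eta> p (u + v) = \<eta> p u + \<eta> p v" "\<eta> p (u - v) = \<eta> p u - \<eta> p v"
    "\<eta> p (- v) = - \<eta> p v" "\<eta> p (a *\<^sub>R v) = a * \<eta> p v"
  using linear_overD[OF eta_linear assms] linear_over_simps[OF tangent_space_subspace eta_linear assms]
  by auto

lemma xi_nonzero: "\<xi> p \<noteq> 0"
proof
  assume "\<xi> p = 0"
  then show False using eta_xi[of p] eta_simps(1)[OF T_simps(1) T_simps(1), of p] by simp
qed

text \<open>Since \<phi> squared kills \<xi>, applying \<phi> squared to \<phi>\<xi> shows that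
  \<phi>\<xi> is a multiple of \<xi>. One more application of \<phi> forces the multiple to be
  0.\<close>

lemma phi_xi: "\<phi> p (\<xi> p) = 0"
proof -
  let ?x = "\<xi> p" and ?y = "\<phi> p (\<xi> p)"
  have x: "?x \<in> T p" and y: "?y \<in> T p" by (simp_all add: phi_tangent)
  have "\<phi> p ?y = 0" using phi_phi[OF x] by (simp add: eta_xi)
  then have 1: "?y = \<eta> p ?y *\<^sub>R ?x"
    using phi_phi[OF y] phi_simps(1)[OF x x] by simp
  have "0 = \<phi> p (\<eta> p ?y *\<^sub>R ?x)" using 1 \<open>\<phi> p ?y = 0\<close> by simp
  also have "\<dots> = \<eta> p ?y *\<^sub>R ?y" by (rule phi_simps(5)[OF x x])
  finally have "\<eta> p ?y = 0 \<or> ?y = 0" by simp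
  then show ?thesis using 1 by auto
qed

text \<open>The cube of \<phi> is evaluated in two ways, with \<phi> squared taken outside and
  inside.\<close>

lemma eta_phi: "v \<in> T p \<Longrightarrow> \<eta> p (\<phi> p v) = 0"
proof -
  assume v: "v \<in> T p"
  have xi: "\<xi> p \<in> T p" by simp
  have "\<phi> p v - \<eta> p (\<phi> p v) *\<^sub>R \<xi> p = \<phi> p (\<phi> p (\<phi> p v))"
    using phi_phi[OF phi_tangent[OF v]] by simp
  also have "\<dots> = \<phi> p (v - \<eta> p v *\<^sub>R \<xi> p)" by (simp add: phi_phi[OF v])
  also have "\<dots> = \<phi> p v"
    by (simp add: phi_simps(3)[OF v T_simps(3)[OF xi]] phi_simps(5)[OF xi xi] phi_xi)
  finally show ?thesis using xi_nonzero by simp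
qed

lemma Phi_add:
  assumes "X \<in> \<XX>" "Y \<in> \<XX>"
  shows "Phi (X + Y) = Phi X + Phi Y" "Phi (X - Y) = Phi X - Phi Y"
  by - (rule ext, simp add: Phi_def phi_simps[OF assms[THEN tangent]])+

lemma Phi_single:
  assumes "X \<in> \<XX>"
  shows "Phi (- X) = - Phi X" "Phi (f \<odot> X) = f \<odot> Phi X" "Phi (Phi X) = X - Eta X \<odot> \<xi>"
    "Eta (Phi X) = 0"
  using assms
  by - (rule ext, simp add: Phi_def Eta_def fscale_def phi_phi eta_phi
      phi_simps[OF tangent[OF assms] tangent[OF assms]])+

lemma Phi_isometry:
  "X \<in> \<XX> \<Longrightarrow> Y \<in> \<XX> \<Longrightarrow> G (Phi X) (Phi Y) = - G X Y + Eta X * Eta Y"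
  by (rule ext) (simp add: Phi_def Eta_def G_def phi_metric)

lemmas Phi_simps = Phi_add Phi_single Phi_isometry

lemma Phi_xi [simp]: "Phi \<xi> = 0"
  by (rule ext) (simp add: Phi_def phi_xi)

lemma Phi_zero [simp]: "Phi 0 = 0"
  using Phi_simps(1)[of 0 0] by simp

lemma Eta_add:
  assumes "X \<in> \<XX>" "Y \<in> \<XX>"
  shows "Eta (X + Y) = Eta X + Eta Y" "Eta (X - Y) = Eta X - Eta Y"
  by - (rule ext, simp add: Eta_def eta_simps[OF assms[THEN tangent]])+

lemma Eta_single:
  assumes "X \<in> \<XX>"
  shows "Eta (- X) = - Eta X" "Eta (f \<odot> X) = f * Eta X"
  by - (rule ext, simp add: Eta_def fscale_def eta_simps[OF tangent[OF assms] tangent[OF assms]])+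

lemmas Eta_simps = Eta_add Eta_single

lemma Eta_xi [simp]: "Eta \<xi> = 1"
  by (rule ext) (simp add: Eta_def eta_xi)

lemma metric_xi: "X \<in> \<XX> \<Longrightarrow> G X \<xi> = Eta X" "X \<in> \<XX> \<Longrightarrow> G \<xi> X = Eta X"
proof -
  assume X: "X \<in> \<XX>"
  show "G X \<xi> = Eta X" using Phi_simps(7)[OF X xi_closed] X by simp
  then show "G \<xi> X = Eta X" using metric_commute X by simp
qed

lemma metric_Phi: "X \<in> \<XX> \<Longrightarrow> Y \<in> \<XX> \<Longrightarrow> G (Phi X) Y = - G X (Phi Y)"
  using Phi_simps(7)[of X "Phi Y"]
  by (simp add: Phi_simps metric_diff metric_simps metric_xi)

lemma d_eta: "X \<in> \<XX> \<Longrightarrow> Y \<in> \<XX> \<Longrightarrow> Eta (lie_bracket X Y) = X \<rhd> Eta Y - Y \<rhd> Eta X"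
  using para_kenmotsu
  by (intro ext) (simp add: para_kenmotsu_def ext_deriv1_def Eta_def lie_fun_def)

text \<open>The factors 1/3 in \<open>ext_deriv2\<close> and \<open>wedge12\<close> cancel; the 2 of
  the para-Kenmotsu condition survives as \<open>W + W\<close>.\<close>

lemma d_Phi:
  assumes "X \<in> \<XX>" "Y \<in> \<XX>" "Z \<in> \<XX>"
  defines "W \<equiv> Eta X * G Y (Phi Z) + Eta Y * G Z (Phi X) + Eta Z * G X (Phi Y)"
  shows "X \<rhd> G Y (Phi Z) + Y \<rhd> G Z (Phi X) + Z \<rhd> G X (Phi Y)
    - G (lie_bracket X Y) (Phi Z) - G (lie_bracket Y Z) (Phi X) - G (lie_bracket Z X) (Phi Y) = W + W"
proof (rule ext)
  fix p
  have "ext_deriv2 (fundamental_form \<phi> g) X Y Z p = 2 * wedge12 \<eta> (fundamental_form \<phi> g) X Y Z p"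
    using para_kenmotsu assms(1,2,3) by (simp add: para_kenmotsu_def)
  then show "(X \<rhd> G Y (Phi Z) + Y \<rhd> G Z (Phi X) + Z \<rhd> G X (Phi Y)
    - G (lie_bracket X Y) (Phi Z) - G (lie_bracket Y Z) (Phi X) - G (lie_bracket Z X) (Phi Y)) p
    = (W + W) p"
    by (simp add: W_def G_def Eta_def Phi_def lie_fun_def ext_deriv2_def wedge12_def fundamental_form_def)
qed

text \<open>This is the vanishing of the Lie derivative of \<phi> along \<xi>. Normality with \<xi>
  in one slot gives it after one application of \<phi>, which can be undone because both sides lie
  in the kernel of \<eta>, where \<phi> squared is the identity.\<close>

lemma Phi_bracket_xi: "X \<in> \<XX> \<Longrightarrow> lie_bracket \<xi> (Phi X) = Phi (lie_bracket \<xi> X)"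
proof -
  assume X: "X \<in> \<XX>"
  let ?B = "lie_bracket \<xi> (Phi X)"
  have "endo_torsion \<phi> \<xi> X p = 0" for p
    using para_kenmotsu X by (simp add: para_kenmotsu_def normal_structure_def)
  then have "Phi (Phi (lie_bracket \<xi> X)) + lie_bracket (Phi \<xi>) (Phi X) - Phi (lie_bracket (Phi \<xi>) X)
      - Phi ?B = 0"
    by (intro ext) (simp add: endo_torsion_def Phi_def Let_def)
  then have "Phi ?B = Phi (Phi (lie_bracket \<xi> X))"
    using X by (simp add: lie_bracket_eq)
  then have "Phi (Phi ?B) = Phi (Phi (Phi (lie_bracket \<xi> X)))" by simp
  moreover have "Eta ?B = 0" using X by (simp add: d_eta Phi_simps)
  ultimately show ?thesis using X by (simp add: Phi_simps)
qed

text \<open>\<open>w\<close> is twice the projection of \<open>v\<close> onto the eigenline of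
  \<phi> for \<open>s\<close> inside the kernel of \<eta>.\<close>

lemma eigenvector:
  assumes "v \<in> T p" "s = 1 \<or> s = -1"
  defines "w \<equiv> v - \<eta> p v *\<^sub>R \<xi> p + s *\<^sub>R \<phi> p v"
  shows "w \<in> T p" "\<eta> p w = 0" "\<phi> p w = s *\<^sub>R w"
proof -
  have xi: "\<eta> p v *\<^sub>R \<xi> p \<in> T p" "\<xi> p \<in> T p" by (simp_all add: T_simps)
  have f: "s *\<^sub>R \<phi> p v \<in> T p" "\<phi> p v \<in> T p" using phi_tangent[OF assms(1)] by (simp_all add: T_simps)
  have d: "v - \<eta> p v *\<^sub>R \<xi> p \<in> T p" using assms(1) xi by (simp add: T_simps)
  show "w \<in> T p" unfolding w_def using d f by (simp add: T_simps)
  show "\<eta> p w = 0"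
    by (simp add: w_def eta_simps(2)[OF d f(1)] eta_simps(3)[OF assms(1) xi(1)]
        eta_simps(5)[OF f(2) f(2)] eta_simps(5)[OF xi(2) xi(2)] eta_phi[OF assms(1)] eta_xi)
  have "\<phi> p w = \<phi> p v + s *\<^sub>R (v - \<eta> p v *\<^sub>R \<xi> p)"
    by (simp add: w_def phi_simps(2)[OF d f(1)] phi_simps(3)[OF assms(1) xi(1)]
        phi_simps(5)[OF f(2) f(2)] phi_simps(5)[OF xi(2) xi(2)] phi_phi[OF assms(1)] phi_xi)
  then show "\<phi> p w = s *\<^sub>R w"
    using assms(2) by (auto simp: w_def algebra_simps)
qed

lemma eigenspace_subspace: "subspace {v \<in> T p. \<eta> p v = 0 \<and> \<phi> p v = s *\<^sub>R v}"
  unfolding subspace_def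
  using eta_simps phi_simps T_simps eta_simps(1)[OF T_simps(1) T_simps(1)]
    phi_simps(1)[OF T_simps(1) T_simps(1)]
  by (auto simp: scaleR_right_distrib)

lemma eigenspace_generator:
  assumes "s = 1 \<or> s = -1"
  shows "\<exists>e\<in>T p. e \<noteq> 0 \<and> \<eta> p e = 0 \<and> \<phi> p e = s *\<^sub>R e \<and>
    (\<forall>v\<in>T p. \<eta> p v = 0 \<longrightarrow> \<phi> p v = s *\<^sub>R v \<longrightarrow> (\<exists>a. v = a *\<^sub>R e))"
proof -
  have "dim {v \<in> T p. \<eta> p v = 0 \<and> \<phi> p v = s *\<^sub>R v} = 1"
    using assms dim_eigenspaces by auto
  from dim_one_subspace[OF eigenspace_subspace this]
  obtain e where "e \<in> {v \<in> T p. \<eta> p v = 0 \<and> \<phi> p v = s *\<^sub>R v}" "e \<noteq> 0"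
    "\<forall>v\<in>{v \<in> T p. \<eta> p v = 0 \<and> \<phi> p v = s *\<^sub>R v}. \<exists>a. v = a *\<^sub>R e"
    by (elim bexE conjE)
  then show ?thesis by (intro bexI[of _ e]) simp_all
qed

lemma field_through:
  assumes v: "v \<in> T p"
  obtains X where "X \<in> \<XX>" "X p = v"
proof -
  obtain e where e: "\<forall>v\<in>T p. \<eta> p v = 0 \<longrightarrow> \<phi> p v = 1 *\<^sub>R v \<longrightarrow> (\<exists>a. v = a *\<^sub>R e)"
    using eigenspace_generator[of 1 p] by auto
  obtain f where f: "\<forall>v\<in>T p. \<eta> p v = 0 \<longrightarrow> \<phi> p v = (-1) *\<^sub>R v \<longrightarrow> (\<exists>a. v = a *\<^sub>R f)"
    using eigenspace_generator[of "-1" p] by auto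
  have "w \<in> span {\<xi> p, e, f}" if w: "w \<in> T p" for w
  proof -
    let ?u = "\<lambda>s. w - \<eta> p w *\<^sub>R \<xi> p + s *\<^sub>R \<phi> p w"
    obtain a b where ab: "?u 1 = a *\<^sub>R e" "?u (-1) = b *\<^sub>R f"
      using e[rule_format, OF eigenvector[OF w, of 1]] f[rule_format, OF eigenvector[OF w, of "-1"]]
      by auto
    have "w = \<eta> p w *\<^sub>R \<xi> p + (1/2) *\<^sub>R ?u 1 + (1/2) *\<^sub>R ?u (-1)"
      by (rule ext) (simp add: scaleR_fun_def field_simps)
    then have "w = \<eta> p w *\<^sub>R \<xi> p + (1/2) *\<^sub>R (a *\<^sub>R e) + (1/2) *\<^sub>R (b *\<^sub>R f)"
      using ab by simp
    moreover have "\<dots> \<in> span {\<xi> p, e, f}"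
      by (intro span_scale span_add span_base) auto
    ultimately show ?thesis by simp
  qed
  moreover have "card {\<xi> p, e, f} \<le> DIM('e)"
    using card_insert_le_m1 dim3 by (simp add: card_insert_if)
  ultimately show ?thesis
    using tangent_extension[OF manifold _ _ _ v, of "{\<xi> p, e, f}"] that by blast
qed

lemma metric_eqI:
  assumes "X \<in> \<XX>" "Y \<in> \<XX>" "\<And>Z. Z \<in> \<XX> \<Longrightarrow> G X Z = G Y Z"
  shows "X = Y"
proof
  fix p
  have "X p - Y p = 0"
  proof (rule metric_nondegenerate)
    show "X p - Y p \<in> T p" using assms by (simp add: T_simps)
    fix v assume "v \<in> T p"
    then obtain Z where Z: "Z \<in> \<XX>" "Z p = v" by (rule field_through)
    have "G (X - Y) Z = 0" using assms Z by (simp add: metric_diff)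
    then have "G (X - Y) Z p = 0" by simp
    then show "g p (X p - Y p) v = 0" using Z(2) by (simp add: G_def)
  qed
  then show "X p = Y p" by simp
qed

text \<open>Closedness of \<eta> makes the covariant derivative of \<xi> self-adjoint, which is
  \<open>sym\<close>. With \<xi> in the first slot and \<open>Phi_bracket_xi\<close>, the equation
  for the exterior derivative of the fundamental form says that its Lie derivative along \<xi> is
  twice itself. Expressed by \<open>D\<close>, this becomes the claim doubled.\<close>

lemma metric_nabla_xi_Phi:
  assumes "X \<in> \<XX>" "Y \<in> \<XX>"
  shows "G (D X \<xi>) (Phi Y) = G X (Phi Y)"
proof -
  have sym: "G (D X \<xi>) Z = G X (D Z \<xi>)" if "Z \<in> \<XX>" for Z
    using d_eta[OF assms(1) that] assms that metric_compatible[of X Z \<xi>] metric_compatible[of Z X \<xi>]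
      metric_commute[of "D X \<xi>" Z]
    by (simp add: metric_xi[symmetric] lie_bracket_eq metric_diff)
  have "G (lie_bracket Y \<xi>) (Phi X) = G X (lie_bracket \<xi> (Phi Y))"
    using assms metric_Phi[of "lie_bracket \<xi> Y" X] metric_commute[of "Phi (lie_bracket \<xi> Y)" X]
    by (simp add: Phi_bracket_xi lie_bracket_anti[of \<xi> Y] metric_uminus)
  then have "\<xi> \<rhd> G X (Phi Y) - G (lie_bracket \<xi> X) (Phi Y) - G X (lie_bracket \<xi> (Phi Y))
      = G X (Phi Y) + G X (Phi Y)"
    using d_Phi[OF xi_closed assms] assms by (simp add: Phi_simps metric_xi)
  then have "G (D X \<xi>) (Phi Y) + G X (D (Phi Y) \<xi>) = G X (Phi Y) + G X (Phi Y)"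
    using assms by (simp add: lie_bracket_eq metric_diff metric_compatible)
  then have "G (D X \<xi>) (Phi Y) + G (D X \<xi>) (Phi Y) = G X (Phi Y) + G X (Phi Y)"
    using assms sym by simp
  then show ?thesis by (rule double_cancel)
qed

text \<open>Test fields split as \<open>Phi (Phi Y) + Eta Y \<odot> \<xi>\<close>: the first part is
  covered by \<open>metric_nabla_xi_Phi\<close>, the second by \<xi> having constant length.\<close>

lemma nabla_xi: "X \<in> \<XX> \<Longrightarrow> D X \<xi> = X - Eta X \<odot> \<xi>"
proof (rule metric_eqI)
  fix Y assume X: "X \<in> \<XX>" and Y: "Y \<in> \<XX>"
  have "G (D X \<xi>) \<xi> + G (D X \<xi>) \<xi> = 0 + 0"
    using metric_compatible[OF X xi_closed xi_closed] metric_commute[of \<xi> "D X \<xi>"] X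
    by (simp add: metric_xi)
  then have "G (D X \<xi>) \<xi> = 0" by (rule double_cancel)
  moreover have "G (D X \<xi>) (Phi (Phi Y)) = G X (Phi (Phi Y))"
    using X Y by (intro metric_nabla_xi_Phi) simp_all
  ultimately show "G (D X \<xi>) Y = G (X - Eta X \<odot> \<xi>) Y"
    using X Y by (simp add: Phi_simps metric_diff metric_simps metric_xi algebra_simps)
qed simp_all

lemma curvature_xi:
  assumes "X \<in> \<XX>" "Y \<in> \<XX>"
  shows "R X Y \<xi> = Eta X \<odot> Y - Eta Y \<odot> X"
proof -
  have d: "Eta (lie_bracket X Y) \<odot> \<xi> = (X \<rhd> Eta Y) \<odot> \<xi> - (Y \<rhd> Eta X) \<odot> \<xi>"
    using d_eta[OF assms] by (simp add: fscale_simps)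
  have t: "D X Y = D Y X + lie_bracket X Y" using assms by (simp add: lie_bracket_eq)
  show ?thesis
    using assms
    by (simp add: curvature_eq nabla_xi connection_diff connection_simps fscale_simps d t algebra_simps)
qed

text \<open>Pair symmetry transports \<open>curvature_xi\<close> to the first slot. Thus
  nondegenerate planes containing \<xi> have sectional curvature -1.\<close>

lemma curvature_xi_left:
  assumes "X \<in> \<XX>" "Z \<in> \<XX>"
  shows "R \<xi> X Z = Eta Z \<odot> X - G X Z \<odot> \<xi>"
proof (rule metric_eqI)
  fix W assume "W \<in> \<XX>"
  then show "G (R \<xi> X Z) W = G (Eta Z \<odot> X - G X Z \<odot> \<xi>) W"
    using assms curvature_pair_symmetric[of \<xi> X Z W] metric_commute[of X Z] metric_commute[of X W]
    by (simp add: curvature_xi metric_diff metric_simps metric_xi algebra_simps)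
qed (use assms in simp_all)

end

section \<open>Null frames\<close>

context para_kenmotsu_manifold
begin

lemma metric_pointwise:
  assumes "u \<in> T p" "v \<in> T p" "w \<in> T p"
  shows "g p 0 w = 0" "g p (u + v) w = g p u w + g p v w" "g p (u - v) w = g p u w - g p v w"
    "g p (a *\<^sub>R v) w = a * g p v w"
  using linear_overD[OF metric_linear(2)[OF assms(3)] assms(1,2)]
    linear_over_simps[OF tangent_space_subspace metric_linear(2)[OF assms(3)] assms(1,2)]
  by auto

lemma metric_sym: "u \<in> T p \<Longrightarrow> v \<in> T p \<Longrightarrow> g p u v = g p v u"
  using metric by (simp add: semi_riemannian_metric_def)

text \<open>Together with \<open>minus_part\<close>, the field version of
  \<open>eigenvector\<close>; again without the factor 1/2 of a projection.\<close>

definition plus_part :: "'m vfield \<Rightarrow> 'm vfield" where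
  "plus_part X = X - Eta X \<odot> \<xi> + Phi X"

definition minus_part :: "'m vfield \<Rightarrow> 'm vfield" where
  "minus_part X = X - Eta X \<odot> \<xi> - Phi X"

lemma parts:
  assumes "X \<in> \<XX>"
  shows "plus_part X \<in> \<XX>" "Phi (plus_part X) = plus_part X"
    "minus_part X \<in> \<XX>" "Phi (minus_part X) = - minus_part X"
  using assms by (simp_all add: plus_part_def minus_part_def Phi_simps)

lemma Eta_eigenfield:
  assumes "X \<in> \<XX>" "Phi X = X \<or> Phi X = - X"
  shows "Eta X = 0"
  using assms Phi_simps(6)[OF assms(1)] Eta_simps(3)[OF assms(1)] by auto

text \<open>\<phi> is skew for the metric, so two fields with the same nonzero eigenvalue are
  orthogonal; in particular eigenfields are null.\<close>

lemma metric_null: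
  assumes "X \<in> \<XX>" "Y \<in> \<XX>" "Phi X = X \<and> Phi Y = Y \<or> Phi X = - X \<and> Phi Y = - Y"
  shows "G X Y = 0"
proof (rule eq_uminus_imp_zero)
  show "G X Y = - G X Y"
    using assms(3) metric_Phi[OF assms(1,2)] metric_uminus[OF assms(1,2)] by auto
qed

lemma eigenfield_multiple:
  assumes "X \<in> \<XX>" "Y \<in> \<XX>" "Phi X = X \<and> Phi Y = Y \<or> Phi X = - X \<and> Phi Y = - Y"
    and "X p \<noteq> 0"
  shows "\<exists>a. Y p = a *\<^sub>R X p"
proof -
  obtain s :: real where s: "s = 1 \<or> s = -1" "\<phi> p (X p) = s *\<^sub>R X p" "\<phi> p (Y p) = s *\<^sub>R Y p"
  proof -
    have "\<phi> p (X p) = Phi X p" "\<phi> p (Y p) = Phi Y p" by (simp_all add: Phi_def)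
    then show ?thesis using that[of 1] that[of "-1"] assms(3) by auto
  qed
  obtain e where e: "\<forall>v\<in>T p. \<eta> p v = 0 \<longrightarrow> \<phi> p v = s *\<^sub>R v \<longrightarrow> (\<exists>a. v = a *\<^sub>R e)"
    using eigenspace_generator[OF s(1), of p] by auto
  have "\<eta> p (X p) = Eta X p" "\<eta> p (Y p) = Eta Y p" by (simp_all add: Eta_def)
  moreover have "Eta X = 0" "Eta Y = 0" using assms by (auto intro: Eta_eigenfield)
  ultimately obtain a b where ab: "X p = a *\<^sub>R e" "Y p = b *\<^sub>R e"
    using e[rule_format, of "X p"] e[rule_format, of "Y p"] s assms by auto
  then have "Y p = (b / a) *\<^sub>R X p" using assms(4) by auto
  then show ?thesis by blast
qed

lemma eigenfields_at:
  shows "\<exists>E\<in>\<XX>. Phi E = E \<and> E p \<noteq> 0" "\<exists>F\<in>\<XX>. Phi F = - F \<and> F p \<noteq> 0"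
proof -
  obtain e where e: "e \<in> T p" "e \<noteq> 0" "\<eta> p e = 0" "\<phi> p e = 1 *\<^sub>R e"
    using eigenspace_generator[of 1 p] by auto
  obtain X where X: "X \<in> \<XX>" "X p = e" by (rule field_through[OF e(1)])
  have "plus_part X p = e + e"
    using e X(2) by (simp add: plus_part_def Eta_def Phi_def fscale_def)
  then have "plus_part X p \<noteq> 0" using e(2) double_cancel[of e 0] by auto
  then show "\<exists>E\<in>\<XX>. Phi E = E \<and> E p \<noteq> 0" using parts[OF X(1)] by blast
next
  obtain e where e: "e \<in> T p" "e \<noteq> 0" "\<eta> p e = 0" "\<phi> p e = (-1) *\<^sub>R e"
    using eigenspace_generator[of "-1" p] by auto
  obtain X where X: "X \<in> \<XX>" "X p = e" by (rule field_through[OF e(1)])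
  have "minus_part X p = e + e"
    using e X(2) by (simp add: minus_part_def Eta_def Phi_def fscale_def)
  then have "minus_part X p \<noteq> 0" using e(2) double_cancel[of e 0] by auto
  then show "\<exists>F\<in>\<XX>. Phi F = - F \<and> F p \<noteq> 0" using parts[OF X(1)] by blast
qed

end

text \<open>No nonvanishing is built in. The separate condition \<open>h p \<noteq> 0\<close>
  expresses that \<xi>, \<open>E\<close> and \<open>F\<close> form a basis at
  \<open>p\<close>.\<close>

locale null_frame = para_kenmotsu_manifold A g D \<phi> \<xi> \<eta>
  for A :: "('m::{t2_space, second_countable_topology}, 'e::euclidean_space) atlas"
    and g :: "'m two_tensor" and D :: "'m connection"
    and \<phi> :: "'m endo_field" and \<xi> :: "'m vfield" and \<eta> :: "'m one_form" +
  fixes E F :: "'m vfield"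
  assumes E_closed [simp]: "E \<in> \<XX>" and F_closed [simp]: "F \<in> \<XX>"
    and Phi_E [simp]: "Phi E = E" and Phi_F [simp]: "Phi F = - F"
begin

abbreviation "h \<equiv> G E F"

lemma Eta_frame [simp]: "Eta E = 0" "Eta F = 0"
  by (auto intro: Eta_eigenfield)

lemma metric_frame [simp]: "G E E = 0" "G F F = 0" "G F E = h" "G \<xi> E = 0" "G E \<xi> = 0"
    "G \<xi> F = 0" "G F \<xi> = 0"
  using metric_commute[of F E] by (simp_all add: metric_null metric_xi)

lemma metric_parts:
  assumes "X \<in> \<XX>"
  shows "G (plus_part X) F = G X F + G X F" "G (minus_part X) E = G X E + G X E"
  using assms metric_Phi[OF assms E_closed] metric_Phi[OF assms F_closed]
  by (simp_all add: plus_part_def minus_part_def metric_simps metric_diff metric_uminus)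

text \<open>\<open>E p\<close> is already orthogonal to \<xi> and to its own eigenline. If it were
  orthogonal to \<open>F p\<close>, which spans the other eigenline, the metric would be
  degenerate.\<close>

lemma frame_metric_nonzero:
  assumes "E p \<noteq> 0" "F p \<noteq> 0"
  shows "h p \<noteq> 0"
proof
  assume 0: "h p = 0"
  have "E p = 0"
  proof (rule metric_nondegenerate)
    show "E p \<in> T p" by simp
    fix v assume "v \<in> T p"
    then obtain X where X: "X \<in> \<XX>" "X p = v" by (rule field_through)
    obtain a where "minus_part X p = a *\<^sub>R F p"
      using eigenfield_multiple[of F "minus_part X" p] parts[OF X(1)] assms by auto
    then have "G (minus_part X) E p = a * G F E p"
      using metric_pointwise(4)[of "F p" p "F p" "E p"] by (simp add: G_def)
    then have "G X E p + G X E p = 0"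
      using metric_parts(2)[OF X(1)] 0 by simp
    then show "g p (E p) v = 0" using metric_sym[OF tangent[OF E_closed] tangent[OF X(1)], of p] X(2) by (simp add: G_def)
  qed
  then show False using assms by simp
qed

lemma frame_expansion_parts:
  assumes "X \<in> \<XX>"
  shows "h \<odot> plus_part X = G (plus_part X) F \<odot> E" "h \<odot> minus_part X = G (minus_part X) E \<odot> F"
proof -
  show "h \<odot> plus_part X = G (plus_part X) F \<odot> E"
  proof (rule ext)
    fix p
    show "(h \<odot> plus_part X) p = (G (plus_part X) F \<odot> E) p"
    proof (cases "E p = 0")
      case True
      then have "h p = 0" using metric_pointwise(1)[OF T_simps(1) T_simps(1) tangent[OF F_closed]] by (simp add: G_def)
      then show ?thesis using True by (simp add: fscale_def)
    next
      case False
      then obtain a where a: "plus_part X p = a *\<^sub>R E p"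
        using eigenfield_multiple[of E "plus_part X" p] parts[OF assms] by auto
      then have "G (plus_part X) F p = a * h p"
        using metric_pointwise(4)[of "E p" p "E p" "F p"] by (simp add: G_def)
      then show ?thesis using a by (simp add: fscale_def mult.commute)
    qed
  qed
  show "h \<odot> minus_part X = G (minus_part X) E \<odot> F"
  proof (rule ext)
    fix p
    show "(h \<odot> minus_part X) p = (G (minus_part X) E \<odot> F) p"
    proof (cases "F p = 0")
      case True
      then have "G F E p = 0" using metric_pointwise(1)[OF T_simps(1) T_simps(1) tangent[OF E_closed]] by (simp add: G_def)
      then show ?thesis using True by (simp add: fscale_def)
    next
      case False
      then obtain a where a: "minus_part X p = a *\<^sub>R F p"
        using eigenfield_multiple[of F "minus_part X" p] parts[OF assms] by auto
      then have "G (minus_part X) E p = a * G F E p"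
        using metric_pointwise(4)[of "F p" p "F p" "E p"] by (simp add: G_def)
      then show ?thesis using a by (simp add: fscale_def mult.commute)
    qed
  qed
qed

text \<open>Valid also where \<open>E\<close> or \<open>F\<close> vanishes: there both sides are zero.  This replaces local
  frames, which need not extend to global ones.\<close>

lemma frame_expansion:
  assumes "X \<in> \<XX>"
  shows "h \<odot> X = (h * Eta X) \<odot> \<xi> + G X F \<odot> E + G X E \<odot> F"
proof (rule double_cancel)
  have "h \<odot> X + h \<odot> X = (h \<odot> plus_part X + h \<odot> minus_part X) + (h \<odot> Eta X \<odot> \<xi> + h \<odot> Eta X \<odot> \<xi>)"
    by (simp add: plus_part_def minus_part_def fscale_simps)
  then show "h \<odot> X + h \<odot> X = ((h * Eta X) \<odot> \<xi> + G X F \<odot> E + G X E \<odot> F)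
      + ((h * Eta X) \<odot> \<xi> + G X F \<odot> E + G X E \<odot> F)"
    unfolding frame_expansion_parts[OF assms] metric_parts[OF assms] fscale_simps by simp
qed

text \<open>The flow of \<xi> preserves \<phi>, so bracketing with \<xi> stays in the same eigenline
  and only one term of \<open>frame_expansion\<close> survives.\<close>

lemma bracket_xi_frame:
  "h \<odot> lie_bracket \<xi> E = G (lie_bracket \<xi> E) F \<odot> E"
  "h \<odot> lie_bracket \<xi> F = G (lie_bracket \<xi> F) E \<odot> F"
proof -
  have E: "Phi (lie_bracket \<xi> E) = lie_bracket \<xi> E"
    using Phi_bracket_xi[OF E_closed] by simp
  have "lie_bracket \<xi> (- F) = - lie_bracket \<xi> F"
    by (simp add: lie_bracket_eq connection_uminus)
  then have F: "Phi (lie_bracket \<xi> F) = - lie_bracket \<xi> F"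
    using Phi_bracket_xi[OF F_closed] by simp
  show "h \<odot> lie_bracket \<xi> E = G (lie_bracket \<xi> E) F \<odot> E"
    using frame_expansion[of "lie_bracket \<xi> E"] E metric_null[of "lie_bracket \<xi> E" E]
      Eta_eigenfield[of "lie_bracket \<xi> E"] by simp
  show "h \<odot> lie_bracket \<xi> F = G (lie_bracket \<xi> F) E \<odot> F"
    using frame_expansion[of "lie_bracket \<xi> F"] F metric_null[of "lie_bracket \<xi> F" F]
      Eta_eigenfield[of "lie_bracket \<xi> F"] by simp
qed

text \<open>The one curvature component of the frame that \<open>curvature_xi_left\<close> leaves
  undetermined. By \<open>bracket_xi_frame\<close>, \<open>aE\<close> and \<open>aF\<close> are
  \<open>h\<close> times the coefficients of the brackets of \<xi> with \<open>E\<close> and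
  \<open>F\<close>.\<close>

abbreviation "k \<equiv> G (R E F F) E"
abbreviation "aE \<equiv> G (lie_bracket \<xi> E) F"
abbreviation "aF \<equiv> G (lie_bracket \<xi> F) E"

lemma nabla_xi_frame: "D \<xi> E = lie_bracket \<xi> E + E" "D \<xi> F = lie_bracket \<xi> F + F"
  by (simp_all add: lie_bracket_eq nabla_xi)

lemma xi_h: "\<xi> \<rhd> h = aE + aF + h + h"
  using metric_commute[of E "lie_bracket \<xi> F"]
  by (simp add: metric_compatible nabla_xi_frame metric_simps)

lemma xi_k:
  "\<xi> \<rhd> k = G (R E F (lie_bracket \<xi> F)) E + G (R (lie_bracket \<xi> E) F F) E
    + G (R E (lie_bracket \<xi> F) F) E + G (R E F F) (lie_bracket \<xi> E) + k + k + h * h + h * h"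
proof -
  have c: "R F \<xi> Z = G F Z \<odot> \<xi> - Eta Z \<odot> F" "R W \<xi> Z = G W Z \<odot> \<xi> - Eta Z \<odot> W"
    if "Z \<in> \<XX>" "W \<in> \<XX>" for Z W
    using curvature_anti[of \<xi> F Z] curvature_anti[of \<xi> W Z] that by (simp_all add: curvature_xi_left)
  have eta: "Eta (D E F) = - h" "Eta (D F F) = 0"
    using metric_compatible[of E F \<xi>] metric_compatible[of F F \<xi>] metric_commute[of F E]
    by (simp_all add: metric_xi[symmetric] nabla_xi eq_neg_iff_add_eq_0)
  \<comment> \<open>Every Bianchi term with \<xi> as an argument of the curvature is explicit. Only
    two of them survive pairing with \<open>E\<close>, and each contributes \<open>h * h\<close> to
    the derivative of \<open>k\<close>.\<close>
  have terms: "G (R (lie_bracket E F) \<xi> F) E = 0" "G (D E (R F \<xi> F)) E = 0"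
    "G (R F \<xi> (D E F)) E = h * h" "G (D F (R \<xi> E F)) E = - (h * h)"
    "G (R \<xi> E (D F F)) E = 0"
    by (simp_all add: c curvature_xi_left metric_simps metric_diff eta connection_simps
        connection_uminus metric_uminus nabla_xi fscale_simps)
  have swap: "R (lie_bracket F \<xi>) E F = R E (lie_bracket \<xi> F) F"
    using curvature_anti[of E "lie_bracket \<xi> F" F] lie_bracket_anti[of \<xi> F]
      curvature_scale(1)[of "- 1" "lie_bracket \<xi> F" E F] by (simp add: fscale_simps)
  \<comment> \<open>The second Bianchi identity solved for the term differentiated along
    \<xi>.\<close>
  have "D \<xi> (R E F F) = R E F (D \<xi> F) + R (lie_bracket \<xi> E) F F + R (lie_bracket E F) \<xi> F
      + R (lie_bracket F \<xi>) E F - (D E (R F \<xi> F) - R F \<xi> (D E F)) - (D F (R \<xi> E F) - R \<xi> E (D F F))"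
    using bianchi_second[of \<xi> E F F] by (simp add: algebra_simps)
  then have "G (D \<xi> (R E F F)) E = G (R E F (D \<xi> F) + R (lie_bracket \<xi> E) F F + R (lie_bracket E F) \<xi> F
      + R (lie_bracket F \<xi>) E F - (D E (R F \<xi> F) - R F \<xi> (D E F)) - (D F (R \<xi> E F) - R \<xi> E (D F F))) E"
    by (rule arg_cong)
  also have "\<dots> = G (R E F (D \<xi> F)) E + G (R (lie_bracket \<xi> E) F F) E + G (R (lie_bracket F \<xi>) E F) E
      + h * h + h * h"
    by (simp add: metric_add metric_diff terms)
  finally have *: "G (D \<xi> (R E F F)) E = G (R E F (lie_bracket \<xi> F)) E + k
      + G (R (lie_bracket \<xi> E) F F) E + G (R E (lie_bracket \<xi> F) F) E + h * h + h * h"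
    by (simp add: swap nabla_xi_frame curvature_add metric_simps)
  have "\<xi> \<rhd> k = G (D \<xi> (R E F F)) E + G (R E F F) (D \<xi> E)"
    by (simp add: metric_compatible)
  then show ?thesis
    unfolding * by (simp add: nabla_xi_frame metric_simps algebra_simps)
qed

text \<open>The brackets are known only after multiplication by \<open>h\<close>. Each of the four
  slots of \<open>k\<close> then returns a multiple of \<open>k\<close>.\<close>

lemma h_xi_k: "h * (\<xi> \<rhd> k) = (aE + aE + aF + aF) * k + h * (k + k + h * h + h * h)"
proof -
  have "h * G (R E F (lie_bracket \<xi> F)) E = G (R E F (h \<odot> lie_bracket \<xi> F)) E"
    "h * G (R (lie_bracket \<xi> E) F F) E = G (R (h \<odot> lie_bracket \<xi> E) F F) E"
    "h * G (R E (lie_bracket \<xi> F) F) E = G (R E (h \<odot> lie_bracket \<xi> F) F) E"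
    "h * G (R E F F) (lie_bracket \<xi> E) = G (R E F F) (h \<odot> lie_bracket \<xi> E)"
    by (simp_all add: curvature_scale metric_simps)
  then have
    "h * G (R E F (lie_bracket \<xi> F)) E = aF * k" "h * G (R (lie_bracket \<xi> E) F F) E = aE * k"
    "h * G (R E (lie_bracket \<xi> F) F) E = aF * k" "h * G (R E F F) (lie_bracket \<xi> E) = aE * k"
    unfolding bracket_xi_frame by (simp_all add: curvature_scale metric_simps)
  then show ?thesis unfolding xi_k by (simp add: algebra_simps)
qed

end

section \<open>Curvature of three-dimensional para-Kenmotsu manifolds\<close>

context null_frame
begin

text \<open>The usual locality argument with a local frame, carried out globally: expanding
  \<open>h \<odot> X\<close> gives coefficients that all vanish at \<open>p\<close> when
  \<open>X p = 0\<close>.\<close>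

lemma tensorial_at_frame:
  assumes h: "h p \<noteq> 0"
    and add: "\<And>X Y. X \<in> \<XX> \<Longrightarrow> Y \<in> \<XX> \<Longrightarrow> L (X + Y) = L X + L Y"
    and scale: "\<And>f X. f \<in> \<FF> \<Longrightarrow> X \<in> \<XX> \<Longrightarrow> L (f \<odot> X) = f \<odot> L X"
    and X: "X \<in> \<XX>" "X p = 0"
  shows "L X p = 0"
proof -
  have "h \<odot> L X = L (h \<odot> X)" using scale X by simp
  also have "\<dots> = L ((h * Eta X) \<odot> \<xi> + G X F \<odot> E + G X E \<odot> F)"
    by (simp only: frame_expansion[OF X(1)])
  also have "\<dots> = (h * Eta X) \<odot> L \<xi> + G X F \<odot> L E + G X E \<odot> L F"
    using X by (simp add: add scale)
  finally have "h p *\<^sub>R L X p = ((h * Eta X) \<odot> L \<xi> + G X F \<odot> L E + G X E \<odot> L F) p"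
    by (metis fscale_apply)
  moreover have "Eta X p = 0"
    using X(2) eta_simps(1)[OF T_simps(1) T_simps(1), of p] by (simp add: Eta_def)
  moreover have "G X F p = 0" "G X E p = 0"
    using X(2) metric_pointwise(1)[OF T_simps(1) T_simps(1) tangent[OF F_closed], of p]
      metric_pointwise(1)[OF T_simps(1) T_simps(1) tangent[OF E_closed], of p]
    by (simp_all add: G_def)
  ultimately show ?thesis using h by (simp add: fscale_apply)
qed

end

context para_kenmotsu_manifold
begin

lemma null_frame_at:
  shows "\<exists>E F. null_frame A g D \<phi> \<xi> \<eta> E F \<and> G E F p \<noteq> 0"
proof -
  obtain E where E: "E \<in> \<XX>" "Phi E = E" "E p \<noteq> 0" using eigenfields_at(1)[of p] by blast
  obtain F where F: "F \<in> \<XX>" "Phi F = - F" "F p \<noteq> 0" using eigenfields_at(2)[of p] by blast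
  interpret null_frame A g D \<phi> \<xi> \<eta> E F
    by unfold_locales (fact E(1) F(1) E(2) F(2))+
  show ?thesis
    using frame_metric_nonzero[OF E(3) F(3)] null_frame_axioms by blast
qed

lemma tensorial:
  assumes add: "\<And>X Y. X \<in> \<XX> \<Longrightarrow> Y \<in> \<XX> \<Longrightarrow> L (X + Y) = L X + L Y"
    and scale: "\<And>f X. f \<in> \<FF> \<Longrightarrow> X \<in> \<XX> \<Longrightarrow> L (f \<odot> X) = f \<odot> L X"
    and X: "X \<in> \<XX>" "Y \<in> \<XX>" "X p = Y p"
  shows "L X p = L Y p"
proof -
  obtain E F where fr: "null_frame A g D \<phi> \<xi> \<eta> E F" "G E F p \<noteq> 0"
    using null_frame_at[of p] by (elim exE conjE)
  interpret null_frame A g D \<phi> \<xi> \<eta> E F by (rule fr(1))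
  have "L (X - Y) p = 0"
    using X by (intro tensorial_at_frame[of p L, OF fr(2) add scale]) simp_all
  moreover have "L X = L (X - Y) + L Y"
    using add[of "X - Y" Y] X by simp
  ultimately show ?thesis by simp
qed

section \<open>Pointwise values of the curvature, independent of the extension\<close>

lemma curvature_cong:
  assumes "X \<in> \<XX>" "Y \<in> \<XX>" "Z \<in> \<XX>" "X' \<in> \<XX>" "Y' \<in> \<XX>" "Z' \<in> \<XX>"
    and "X p = X' p" "Y p = Y' p" "Z p = Z' p"
  shows "R X Y Z p = R X' Y' Z' p"
proof -
  have "R X Y Z p = R X' Y Z p"
    using assms by (intro tensorial[of "\<lambda>X. R X Y Z"]) (simp_all add: curvature_add curvature_scale)
  also have "\<dots> = R X' Y' Z p"
    using assms by (intro tensorial[of "\<lambda>Y. R X' Y Z"]) (simp_all add: curvature_add curvature_scale)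
  also have "\<dots> = R X' Y' Z' p"
    using assms by (intro tensorial[of "\<lambda>Z. R X' Y' Z"]) (simp_all add: curvature_add curvature_scale)
  finally show ?thesis .
qed

lemma extend_field:
  assumes "v \<in> T p"
  shows "extend A p v \<in> \<XX>" "extend A p v p = v"
proof -
  obtain X where "X \<in> \<XX>" "X p = v" by (rule field_through[OF assms])
  then have "\<exists>X. X \<in> \<XX> \<and> X p = v" by blast
  from someI_ex[OF this] show "extend A p v \<in> \<XX>" "extend A p v p = v"
    by (simp_all add: extend_def)
qed

lemma curvature_at_eq:
  assumes "X \<in> \<XX>" "Y \<in> \<XX>" "Z \<in> \<XX>"
  shows "curvature_at A D p (X p) (Y p) (Z p) = R X Y Z p"
  unfolding curvature_at_def
  by (rule curvature_cong) (simp_all add: assms extend_field)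

end

context null_frame
begin

section \<open>Ricci and scalar curvature in a null frame\<close>

lemma frame_expansion_at:
  assumes "h p \<noteq> 0" "v \<in> T p"
  shows "v = \<eta> p v *\<^sub>R \<xi> p + (g p v (F p) / h p) *\<^sub>R E p + (g p v (E p) / h p) *\<^sub>R F p"
proof -
  obtain X where X: "X \<in> \<XX>" "X p = v" by (rule field_through[OF assms(2)])
  have "h p *\<^sub>R v = (h p * \<eta> p v) *\<^sub>R \<xi> p + g p v (F p) *\<^sub>R E p + g p v (E p) *\<^sub>R F p"
    using fun_cong[OF frame_expansion[OF X(1)], of p] X(2)
    by (simp add: fscale_apply Eta_def G_def)
  then have "(1 / h p) *\<^sub>R h p *\<^sub>R v = (1 / h p) *\<^sub>R
      ((h p * \<eta> p v) *\<^sub>R \<xi> p + g p v (F p) *\<^sub>R E p + g p v (E p) *\<^sub>R F p)"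
    by (rule arg_cong)
  then show ?thesis using assms(1) by (simp add: scaleR_right_distrib)
qed

lemma trace_over_null_frame:
  assumes h: "h p \<noteq> 0" and L: "linear_over (T p) L" "L ` T p \<subseteq> T p"
  shows "trace_over (T p) L = \<eta> p (L (\<xi> p)) + g p (L (E p)) (F p) / h p + g p (L (F p)) (E p) / h p"
proof -
  define e where "e i = (if i = 0 then \<xi> p else if i = 1 then E p else F p)" for i :: nat
  \<comment> \<open>The dual coframe. As \<open>E\<close> and \<open>F\<close> are null, the
    coefficient of \<open>E\<close> is found by pairing with \<open>F\<close>, and
    conversely.\<close>
  define \<theta> where "\<theta> i v = (if i = 0 then \<eta> p v else if i = 1 then g p v (F p) / h p else g p v (E p) / h p)"
    for i :: nat and v
  have "trace_over (T p) L = (\<Sum>i\<in>{0, 1, 2}. \<theta> i (L (e i)))"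
  proof (rule trace_over_frame[OF tangent_space_subspace L])
    show "finite {0, 1, 2::nat}" by simp
    show "e i \<in> T p" for i by (simp add: e_def)
    show "v = (\<Sum>i\<in>{0, 1, 2}. \<theta> i v *\<^sub>R e i)" if "v \<in> T p" for v
      using frame_expansion_at[OF h that] by (simp add: e_def \<theta>_def add.assoc)
    have "linear_over (T p) (\<lambda>v. g p v (Y p) / h p)" if "Y \<in> \<XX>" for Y
      using metric_pointwise[OF _ _ tangent[OF that]] by (simp add: linear_over_def add_divide_distrib)
    moreover have "\<theta> i = (if i = 0 then \<eta> p else if i = 1 then (\<lambda>v. g p v (F p) / h p)
        else (\<lambda>v. g p v (E p) / h p))" for i
      by (rule ext) (simp add: \<theta>_def)
    ultimately show "linear_over (T p) (\<theta> i)" for i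
      using eta_linear[of p] E_closed F_closed by presburger
  qed
  then show ?thesis by (simp add: e_def \<theta>_def)
qed

lemma ricci_eq:
  assumes h: "h p \<noteq> 0" and "X \<in> \<XX>" "Y \<in> \<XX>"
  shows "ricci A D p (X p) (Y p) = Eta (R \<xi> X Y) p + G (R E X Y) F p / h p + G (R F X Y) E p / h p"
proof -
  let ?L = "\<lambda>w. curvature_at A D p w (X p) (Y p)"
  have "linear_over (T p) ?L"
    unfolding linear_over_def
  proof (intro conjI ballI allI)
    fix u v assume "u \<in> T p" "v \<in> T p"
    then obtain U V where UV: "U \<in> \<XX>" "V \<in> \<XX>" "u = U p" "v = V p"
      using field_through by metis
    then show "?L (u + v) = ?L u + ?L v"
      using assms curvature_at_eq[of "U + V" X Y p]
      by (simp add: curvature_at_eq curvature_add)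
  next
    fix a v assume "v \<in> T p"
    then obtain V where V: "V \<in> \<XX>" "v = V p" using field_through by metis
    \<comment> \<open>Scaling a tangent vector by a number is realised on its extension as scaling
      by a constant function.\<close>
    have c: "(\<lambda>q. a) \<in> \<FF>" by (rule smooth_funs_const[OF manifold])
    show "?L (a *\<^sub>R v) = a *\<^sub>R ?L v"
      using assms V c curvature_at_eq[of "(\<lambda>q. a) \<odot> V" X Y p]
      by (simp add: curvature_at_eq curvature_scale fscale_apply)
  qed
  moreover have "?L ` T p \<subseteq> T p"
  proof
    fix w assume "w \<in> ?L ` T p"
    then obtain v where v: "v \<in> T p" "w = ?L v" by blast
    obtain V where V: "V \<in> \<XX>" "V p = v" by (rule field_through[OF v(1)])
    have "w = R V X Y p" using curvature_at_eq[of V X Y p] V v assms by simp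
    then show "w \<in> T p" using V assms by simp
  qed
  ultimately show ?thesis
    using trace_over_null_frame[OF h, of ?L] assms
    by (simp add: ricci_def curvature_at_eq Eta_def G_def)
qed

lemma ricci_linear:
  assumes h: "h p \<noteq> 0" and u: "u \<in> T p"
  shows "linear_over (T p) (ricci A D p u)" "linear_over (T p) (\<lambda>v. ricci A D p v u)"
proof -
  obtain U where U: "U \<in> \<XX>" "U p = u" by (rule field_through[OF u])
  have add: "ricci A D p u ((V + W) p) = ricci A D p u (V p) + ricci A D p u (W p)"
    "ricci A D p ((V + W) p) u = ricci A D p (V p) u + ricci A D p (W p) u"
    if "V \<in> \<XX>" "W \<in> \<XX>" for V W
    unfolding U(2)[symmetric] using that U(1)
    by (simp_all add: ricci_eq[OF h] del: plus_fun_apply)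
      (simp_all add: curvature_add Eta_simps metric_add add_divide_distrib)
  have scale: "ricci A D p u (((\<lambda>q. a) \<odot> V) p) = a * ricci A D p u (V p)"
    "ricci A D p (((\<lambda>q. a) \<odot> V) p) u = a * ricci A D p (V p) u"
    if "V \<in> \<XX>" for V a
    unfolding U(2)[symmetric] using that U(1) smooth_funs_const[OF manifold, of a]
    by (simp_all add: ricci_eq[OF h] curvature_scale Eta_simps metric_scale distrib_left)
  show "linear_over (T p) (ricci A D p u)" "linear_over (T p) (\<lambda>v. ricci A D p v u)"
    unfolding linear_over_def
    using add scale by (auto simp: fscale_apply elim!: field_through)
qed

lemma scalar_curvature_eq:
  assumes h: "h p \<noteq> 0"
  shows "scalar_curvature A g D p = ricci A D p (\<xi> p) (\<xi> p) + ricci A D p (E p) (F p) / h p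
    + ricci A D p (F p) (E p) / h p"
proof -
  let ?S = "ricci A D p"
  let ?Q = "\<lambda>u. THE w. w \<in> T p \<and> (\<forall>v\<in>T p. g p w v = ?S u v)"
  \<comment> \<open>The explicit solution of the condition under \<open>THE\<close>: the metric dual
    of \<open>?S u\<close>, again with \<open>E\<close> and \<open>F\<close> exchanged.
    Nondegeneracy makes it unique.\<close>
  define q where "q u = ?S u (\<xi> p) *\<^sub>R \<xi> p + (?S u (F p) / h p) *\<^sub>R E p + (?S u (E p) / h p) *\<^sub>R F p" for u
  have fr: "\<xi> p \<in> T p" "E p \<in> T p" "F p \<in> T p" by simp_all
  have qT: "q u \<in> T p" for u by (simp add: q_def T_simps)
  have gq: "g p (q u) v = ?S u v" if u: "u \<in> T p" and v: "v \<in> T p" for u v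
  proof -
    have S: "?S u (x + y) = ?S u x + ?S u y" "?S u (a *\<^sub>R x) = a * ?S u x"
      "g p (x + y) v = g p x v + g p y v" "g p (a *\<^sub>R x) v = a * g p x v"
      if "x \<in> T p" "y \<in> T p" for x y a
      using linear_overD[OF ricci_linear(1)[OF h u] that] linear_overD[OF ricci_linear(1)[OF h u] that(1,1)]
        metric_pointwise(2)[OF that v] metric_pointwise(4)[OF that(1,1) v] by simp_all
    note scale = S(2)[OF _ fr(1)] S(4)[OF _ fr(1)]
    have "?S u v = ?S u (\<eta> p v *\<^sub>R \<xi> p + (g p v (F p) / h p) *\<^sub>R E p + (g p v (E p) / h p) *\<^sub>R F p)"
      using frame_expansion_at[OF h v] by (rule arg_cong)
    also have "\<dots> = \<eta> p v * ?S u (\<xi> p) + (g p v (F p) / h p) * ?S u (E p) + (g p v (E p) / h p) * ?S u (F p)"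
      by (simp add: S(1) scale T_simps)
    finally have "?S u v = \<dots>" .
    moreover have "g p (\<xi> p) v = \<eta> p v"
    proof -
      obtain X where X: "X \<in> \<XX>" "X p = v" by (rule field_through[OF v])
      show ?thesis using fun_cong[OF metric_xi(2)[OF X(1)], of p] X(2) by (simp add: G_def Eta_def)
    qed
    ultimately show ?thesis
      by (simp add: q_def S(3) scale T_simps metric_sym[OF v] mult.commute)
  qed
  have Q: "?Q u = q u" if u: "u \<in> T p" for u
  proof (rule the_equality)
    show "q u \<in> T p \<and> (\<forall>v\<in>T p. g p (q u) v = ?S u v)" using qT gq[OF u] by blast
    fix w assume w: "w \<in> T p \<and> (\<forall>v\<in>T p. g p w v = ?S u v)"
    have "w - q u = 0"
    proof (rule metric_nondegenerate)
      show "w - q u \<in> T p" using w qT by (simp add: T_simps)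
      fix v assume v: "v \<in> T p"
      then show "g p (w - q u) v = 0"
        using metric_pointwise(3)[of w p "q u" v] w qT gq[OF u v] by simp
    qed
    then show "w = q u" by simp
  qed
  have qlin: "q (u + v) = q u + q v" "q (a *\<^sub>R v) = a *\<^sub>R q v" if "u \<in> T p" "v \<in> T p" for u v a
    using linear_overD[OF ricci_linear(2)[OF h fr(1)] that] linear_overD[OF ricci_linear(2)[OF h fr(2)] that]
      linear_overD[OF ricci_linear(2)[OF h fr(3)] that]
    by (simp_all add: q_def add_divide_distrib scaleR_left_distrib scaleR_right_distrib algebra_simps)
  have "linear_over (T p) ?Q"
    unfolding linear_over_def using Q qlin by (simp add: T_simps)
  moreover have "?Q ` T p \<subseteq> T p" using Q qT by auto
  ultimately have "scalar_curvature A g D p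
      = \<eta> p (q (\<xi> p)) + g p (q (E p)) (F p) / h p + g p (q (F p)) (E p) / h p"
    using trace_over_null_frame[OF h, of ?Q] Q fr
    by (simp add: scalar_curvature_def metric_trace_def)
  moreover have "\<eta> p (q (\<xi> p)) = g p (q (\<xi> p)) (\<xi> p)"
  proof -
    obtain X where X: "X \<in> \<XX>" "X p = q (\<xi> p)" by (rule field_through[OF qT])
    show ?thesis using fun_cong[OF metric_xi(1)[OF X(1)], of p] X(2) by (simp add: G_def Eta_def)
  qed
  ultimately show ?thesis using gq fr by simp
qed

text \<open>The Ricci tensor is -2 on (\<xi>, \<xi>), and each mixed entry divided by
  \<open>h\<close> is -1 - k/h^2. Clearing the denominator prepares the extension to points where
  \<open>h\<close> vanishes.\<close>

lemma scalar_curvature_frame: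
  assumes h: "h p \<noteq> 0"
  shows "scalar_curvature A g D p * (h p)\<^sup>2 + 4 * (h p)\<^sup>2 + 2 * k p = 0"
proof -
  have "R E \<xi> \<xi> = - E" "R F \<xi> \<xi> = - F"
    using curvature_anti[of \<xi> E \<xi>] curvature_anti[of \<xi> F \<xi>] by (simp_all add: curvature_xi_left)
  moreover have "R \<xi> \<xi> \<xi> = 0" by (simp add: curvature_xi_left metric_xi)
  ultimately have "ricci A D p (\<xi> p) (\<xi> p) = - 2"
    using h Eta_simps(1)[of 0 0] by (simp add: ricci_eq metric_uminus)
  moreover have "ricci A D p (E p) (F p) = - h p - k p / h p"
  proof -
    have "R E E F = 0" by (intro eq_uminus_imp_zero curvature_anti) simp_all
    moreover have "G (R F E F) E = - k" using curvature_anti[of E F F] by (simp add: metric_uminus)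
    ultimately show ?thesis using h
      by (simp add: ricci_eq curvature_xi_left Eta_simps)
  qed
  moreover have "ricci A D p (F p) (E p) = - h p - k p / h p"
  proof -
    have "R F F E = 0" by (intro eq_uminus_imp_zero curvature_anti) simp_all
    moreover have "G (R E F E) F = - k"
      using curvature_skew[of E F E F] metric_commute[of E "R E F F"] by simp
    ultimately show ?thesis using h
      by (simp add: ricci_eq curvature_xi_left Eta_simps)
  qed
  ultimately have "scalar_curvature A g D p = - 2 + (- h p - k p / h p) / h p + (- h p - k p / h p) / h p"
    by (simp only: scalar_curvature_eq[OF h])
  also have "\<dots> = - 4 - 2 * (k p / (h p)\<^sup>2)"
    using h by (simp add: diff_divide_distrib power2_eq_square)
  finally have "scalar_curvature A g D p * (h p)\<^sup>2 = (- 4 - 2 * (k p / (h p)\<^sup>2)) * (h p)\<^sup>2"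
    by (rule arg_cong)
  also have "\<dots> = - 4 * (h p)\<^sup>2 - 2 * k p"
    using h by (simp add: left_diff_distrib)
  finally show ?thesis by simp
qed

text \<open>A zero of \<open>h\<close> is a zero of \<open>E\<close> or \<open>F\<close>, hence of
  \<open>k\<close>. The relation thus becomes an identity of functions on the whole manifold, which
  \<xi> may differentiate.\<close>

lemma scalar_curvature_global:
  "scalar_curvature A g D p * (h p)\<^sup>2 + 4 * (h p)\<^sup>2 + 2 * k p = 0"
proof (cases "h p = 0")
  case False
  then show ?thesis by (rule scalar_curvature_frame)
next
  case True
  then consider "E p = 0" | "F p = 0" using frame_metric_nonzero by blast
  then have "k p = 0"
  proof cases
    case 1
    then show ?thesis
      using metric_sym[of "R E F F p" p 0] metric_pointwise(1)[OF T_simps(1) T_simps(1), of "R E F F p" p]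
        T_simps(1)[of A p] by (simp add: G_def)
  next
    case 2
    have "R E F F p = R E F 0 p" by (rule curvature_cong) (simp_all add: 2)
    moreover have "R E F 0 = 0" using curvature_scale(3)[of 0 0 E F] by simp
    ultimately have "R E F F p = 0" by (simp add: fun_eq_iff)
    then have "k p = g p 0 (E p)" by (simp only: G_def)
    also have "\<dots> = 0" by (rule metric_pointwise(1)[OF T_simps(1) T_simps(1) tangent[OF E_closed]])
    finally show ?thesis .
  qed
  then show ?thesis using True by simp
qed

lemma xi_scalar_curvature:
  assumes r: "scalar_curvature A g D \<in> \<FF>" and h: "h p \<noteq> 0"
  shows "(\<xi> \<rhd> scalar_curvature A g D) p = - 2 * (scalar_curvature A g D p + 6)"
proof -
  let ?r = "scalar_curvature A g D"
  have "?r * (h * h) + (h * h + h * h + h * h + h * h) + (k + k) = 0"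
    using scalar_curvature_global by (intro ext) (simp add: power2_eq_square)
  then have "\<xi> \<rhd> (?r * (h * h) + (h * h + h * h + h * h + h * h) + (k + k)) = 0" by simp
  then have "((\<xi> \<rhd> ?r) * (h * h) + ?r * ((\<xi> \<rhd> h) * h + h * (\<xi> \<rhd> h))
      + ((\<xi> \<rhd> h) * h + h * (\<xi> \<rhd> h) + ((\<xi> \<rhd> h) * h + h * (\<xi> \<rhd> h)) + ((\<xi> \<rhd> h) * h + h * (\<xi> \<rhd> h))
      + ((\<xi> \<rhd> h) * h + h * (\<xi> \<rhd> h))) + (\<xi> \<rhd> k + \<xi> \<rhd> k)) p = 0"
    using r by (simp only: lie_fun_add lie_fun_mult smooth_fun_closed metric_closed curvature_closed
        E_closed F_closed xi_closed zero_fun_apply)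
  then have 1: "(\<xi> \<rhd> ?r) p * (h p * h p) + (2 * ?r p + 8) * (h p * (\<xi> \<rhd> h) p) + 2 * (\<xi> \<rhd> k) p = 0"
    by (simp add: algebra_simps)
  have 2: "(\<xi> \<rhd> h) p = aE p + aF p + 2 * h p" by (simp add: xi_h)
  have 3: "h p * (\<xi> \<rhd> k) p = 2 * (aE p + aF p) * k p + h p * (2 * k p + 2 * (h p * h p))"
    using fun_cong[OF h_xi_k, of p] by (simp add: algebra_simps)
  have 4: "?r p * (h p * h p) + 4 * (h p * h p) + 2 * k p = 0"
    using scalar_curvature_global[of p] by (simp add: power2_eq_square)
  \<comment> \<open>After multiplying the differentiated relation by \<open>h\<close>, the sum
    \<open>aE + aF\<close> appears with twice the left-hand side of \<open>4\<close> as its factor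
    and drops out; \<open>4\<close> also eliminates the remaining \<open>k\<close>.\<close>
  have "h p * h p * h p * ((\<xi> \<rhd> ?r) p + 2 * ?r p + 12) = 0"
    using 1 2 3 4 by algebra
  then show ?thesis using h by simp
qed

end

context para_kenmotsu_manifold
begin

text \<open>The soliton equation is tested on two pairs: (\<xi>, \<xi>) sees only the derivative of
  \<open>b\<close>, whereas on (\<open>E\<close>, \<open>F\<close>) the bracket terms cancel and the
  factor 2 in the derivative of \<open>h\<close> along \<xi> leaves \<open>2 * b\<close>.\<close>

lemma yamabe_soliton_collinear_zero:
  assumes sol: "yamabe_soliton A g D V lam" and b: "b \<in> \<FF>" and V: "V = b \<odot> \<xi>"
  shows "V = 0"
proof -
  let ?r = "scalar_curvature A g D"
  have VX: "V \<in> \<XX>" using b V by simp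
  have eq: "(V \<rhd> G X Y - G (lie_bracket V X) Y - G X (lie_bracket V Y)) p = (lam - ?r p) * G X Y p"
    if "X \<in> \<XX>" "Y \<in> \<XX>" for X Y p
    using sol that by (simp add: yamabe_soliton_def lie_deriv_def lie_fun_def G_def)
  have br: "lie_bracket V X = b \<odot> lie_bracket \<xi> X - (X \<rhd> b) \<odot> \<xi>" if "X \<in> \<XX>" for X
    using that b by (simp add: V lie_bracket_eq connection_scale fscale_simps)
  have "lie_bracket \<xi> \<xi> = 0" by (simp add: lie_bracket_eq)
  then have 1: "lam - ?r p = 2 * (\<xi> \<rhd> b) p" for p
    using eq[OF xi_closed xi_closed, of p] b
    by (simp add: br metric_xi Eta_single VX)
  have 2: "lam - ?r p = 2 * b p" for p
  proof -
    obtain E F where fr: "null_frame A g D \<phi> \<xi> \<eta> E F" "G E F p \<noteq> 0"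
      using null_frame_at[of p] by (elim exE conjE)
    interpret null_frame A g D \<phi> \<xi> \<eta> E F by (rule fr(1))
    have "V \<rhd> h = b * (aE + aF + h + h)" by (simp add: V lie_fun_field_simps xi_h)
    moreover have "G (lie_bracket V E) F = b * aE" "G E (lie_bracket V F) = b * aF"
      using b metric_commute[of E "lie_bracket \<xi> F"]
      by (simp_all add: br metric_diff metric_scale)
    ultimately have "b p * (2 * h p) = (lam - ?r p) * h p"
      using eq[OF E_closed F_closed, of p] by (simp add: algebra_simps)
    then show ?thesis using fr(2) by simp
  qed
  have xib: "\<xi> \<rhd> b = b"
  proof
    show "(\<xi> \<rhd> b) p = b p" for p using 1[of p] 2[of p] by simp
  qed
  have c: "(\<lambda>q. lam) \<in> \<FF>" by (rule smooth_funs_const[OF manifold])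
  \<comment> \<open>This supplies the smoothness of the scalar curvature required by
    \<open>xi_scalar_curvature\<close>.\<close>
  have r: "?r = (\<lambda>q. lam) - (b + b)"
  proof
    show "?r p = ((\<lambda>q. lam) - (b + b)) p" for p using 2[of p] by simp
  qed
  have x1: "(\<xi> \<rhd> ?r) p = - 2 * b p" for p
  proof -
    have "\<xi> \<rhd> ?r = \<xi> \<rhd> (\<lambda>q. lam) - (b + b)"
      by (simp only: r lie_fun_diff[OF xi_closed c smooth_fun_closed(3)[OF b b]]
          lie_fun_add[OF xi_closed b b] xib)
    moreover have "(\<xi> \<rhd> (\<lambda>q. lam)) p = 0" by (simp add: lie_fun_def)
    ultimately show ?thesis by simp
  qed
  have x2: "(\<xi> \<rhd> ?r) p = - 2 * (?r p + 6)" for p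
  proof -
    obtain E F where fr: "null_frame A g D \<phi> \<xi> \<eta> E F" "G E F p \<noteq> 0"
      using null_frame_at[of p] by (elim exE conjE)
    interpret null_frame A g D \<phi> \<xi> \<eta> E F by (rule fr(1))
    have "?r \<in> \<FF>" unfolding r using b c by simp
    then show ?thesis using fr(2) by (rule xi_scalar_curvature)
  qed
  \<comment> \<open>Equating \<open>x1\<close> and \<open>x2\<close> gives \<open>b = r + 6\<close>;
    now insert \<open>r = lam - 2 * b\<close>.\<close>
  have "b p = (lam + 6) / 3" for p
    using x1[of p] x2[of p] 2[of p] by simp
  then have bc: "b = (\<lambda>q. (lam + 6) / 3)" by (rule ext)
  have "b p = \<xi> p b" for p
    using fun_cong[OF xib, of p] by (simp add: lie_fun_def)
  then have "b p = 0" for p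
    using lie_fun_const[OF xi_closed, of p "(lam + 6) / 3"] unfolding bc by simp
  then have "b = 0" by (intro ext) simp
  then show ?thesis by (simp add: V)
qed

end

text \<open>The zero field is collinear with \<xi> through \<open>b = 0\<close>, and it solves the
  soliton equation whenever r is constantly \<open>lam\<close>; a genuine soliton field therefore
  has to be nonzero somewhere.\<close>

theorem proposition2:
  fixes A :: "('m::{t2_space, second_countable_topology}, real^3) atlas"
    and \<phi> :: "'m endo_field" and \<xi> V :: "'m vfield" and \<eta> :: "'m one_form"
    and g :: "'m two_tensor" and D :: "'m connection" and lam :: real
  assumes "para_kenmotsu A \<phi> \<xi> \<eta> g"
    and "levi_civita A g D"
    and "yamabe_soliton A g D V lam"
    and "\<exists>p. V p \<noteq> 0"
  shows "\<not> pointwise_collinear A V \<xi>"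
proof
  assume "pointwise_collinear A V \<xi>"
  then obtain b where b: "b \<in> smooth_funs A" "\<forall>p. V p = b p *\<^sub>R \<xi> p"
    unfolding pointwise_collinear_def by blast
  interpret para_kenmotsu_manifold A g D \<phi> \<xi> \<eta>
    using assms(1,2)
    by unfold_locales (simp_all add: para_kenmotsu_def almost_paracontact_metric_def almost_paracontact_def)
  have "V = b \<odot> \<xi>" using b(2) by (simp add: fscale_def fun_eq_iff)
  then have "V = 0" by (rule yamabe_soliton_collinear_zero[OF assms(3) b(1)])
  then show False using assms(4) by simp
qed

end
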